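(* Let $\boldsymbol m,\boldsymbol l,k$ be consistent parameters. There exists a unique linear differential operator $D_{\boldsymbol l,k}$ of order $k$ and of the form $$D_{\boldsymbol l,k}=D_{j(k)}\Big(\sum_{s=1}^{k-1}\boldsymbol 1_{j(s)},\,k-1\Big)\cdots D_{j(2)}(\boldsymbol 1_{j(1)},1)\,D_{j(1)}(\boldsymbol 0,0)$$ with $j(s)\in\{0,\dots,r\}$, $\sum_{s=1}^k\boldsymbol 1_{j(s)}=\boldsymbol l$, such that $V(\boldsymbol l,k)=D_{\boldsymbol l,k}\,V(\boldsymbol 0,0)$.
   Context: Fix an integer $r\ge1$. For $\boldsymbol m=(m_1,\dots,m_r)$, $\boldsymbol l=(l_1,\dots,l_r)$ and $k$ put $l_0=k$, $l_{r+1}=0$. The parameters $\boldsymbol m,\boldsymbol l,k$ are consistent if all $m_i,l_i,k$ are non-negative integers, $k\ge l_1\ge\dots\ge l_r\ge0$ and $l_s-l_{s+1}\le m_s$ for $s=1,\dots,r$. Put $e_i(\boldsymbol l,k)=k+\sum_{s=1}^im_s-l_i+l_{i+1}+i$, $i=0,\dots,r$. For consistent parameters, $V(\boldsymbol l,k)=V(\boldsymbol m,\boldsymbol l,k)$ is the unique $(r+1)$-dimensional complex vector space of polynomials in $x$ such that the set of degrees of its non-zero elements is $\{e_0<\dots<e_r\}$, the set of orders of vanishing at $x=0$ of its non-zero elements is $\{i+\sum_{s=1}^i m_s: i=0,\dots,r\}$, and the set of orders of vanishing at $x=1$ is $\{0,k+1,k+2,\dots,k+r\}$ (existence and uniqueness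 are known; the Wronskian then has no zeros other than $0,1$). In particular $V(\boldsymbol 0,0)=\mathrm{span}\{x^{i+m_1+\dots+m_i}\}_{i=0}^r$. $\boldsymbol 1_i=(1,\dots,1,0,\dots,0)\in\mathbb Z^r$ has $i$ ones followed by $r-i$ zeros. For $i=0,\dots,r$, $$D_i(\boldsymbol l,k)=x(x-1)\frac{d}{dx}-e_i(\boldsymbol l,k)(x-1)-k-1 .$$ Here $\boldsymbol m$ is fixed throughout. For $k=0$ the operator is the identity (empty product). *)

theory Defs
  imports Complex_Main "HOL-Computational_Algebra.Polynomial"
begin

interpretation poly_vs: vector_space "smult :: complex \<Rightarrow> complex poly \<Rightarrow> complex poly"
  by unfold_locales (simp_all add: smult_add_right smult_add_left)

text \<open>
  Tuples indexed by \<open>1, \<dots>, r\<close> are functions \<open>nat \<Rightarrow> nat\<close>; values at other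
  indices are never used. The tuple \<open>l\<close> is read through \<open>ext_l\<close>, which adds the conventions
  \<open>l\<^sub>0 = k\<close> and \<open>l\<^sub>r\<^sub>+\<^sub>1 = 0\<close>.
\<close>

definition ext_l :: "nat \<Rightarrow> (nat \<Rightarrow> nat) \<Rightarrow> nat \<Rightarrow> nat \<Rightarrow> int" where
  "ext_l r l k i = (if i = 0 then int k else if i \<le> r then int (l i) else 0)"

definition consistent :: "nat \<Rightarrow> (nat \<Rightarrow> nat) \<Rightarrow> (nat \<Rightarrow> nat) \<Rightarrow> nat \<Rightarrow> bool" where
  "consistent r m l k \<longleftrightarrow>
     (\<forall>s\<in>{0..r}. ext_l r l k s \<ge> ext_l r l k (s + 1)) \<and>
     (\<forall>s\<in>{1..r}. ext_l r l k s - ext_l r l k (s + 1) \<le> int (m s))"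

definition e :: "nat \<Rightarrow> (nat \<Rightarrow> nat) \<Rightarrow> nat \<Rightarrow> (nat \<Rightarrow> nat) \<Rightarrow> nat \<Rightarrow> int" where
  "e r m i l k = int k + (\<Sum>s=1..i. int (m s)) - ext_l r l k i + ext_l r l k (i + 1) + int i"

definition is_V :: "nat \<Rightarrow> (nat \<Rightarrow> nat) \<Rightarrow> (nat \<Rightarrow> nat) \<Rightarrow> nat \<Rightarrow> complex poly set \<Rightarrow> bool" where
  "is_V r m l k W \<longleftrightarrow>
     poly_vs.subspace W \<and> poly_vs.dim W = r + 1 \<and>
     (\<lambda>f. int (degree f)) ` (W - {0}) = (\<lambda>i. e r m i l k) ` {0..r} \<and>
     order 0 ` (W - {0}) = (\<lambda>i. i + (\<Sum>s=1..i. m s)) ` {0..r} \<and>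
     order 1 ` (W - {0}) = insert 0 {k + 1..k + r}"

definition V :: "nat \<Rightarrow> (nat \<Rightarrow> nat) \<Rightarrow> (nat \<Rightarrow> nat) \<Rightarrow> nat \<Rightarrow> complex poly set" where
  "V r m l k = (THE W. is_V r m l k W)"

definition one_vec :: "nat \<Rightarrow> nat \<Rightarrow> nat" where
  "one_vec i s = (if 1 \<le> s \<and> s \<le> i then 1 else 0)"

text \<open>
  Differential operators with polynomial coefficients are identified with the maps they induce
  on \<open>\<complex>[x]\<close>. In characteristic zero this action is faithful, so equality of maps is
  equality of operators, and the coefficients \<open>a\<close> below are determined by the map.
\<close>

definition diffop_of_order :: "nat \<Rightarrow> (complex poly \<Rightarrow> complex poly) \<Rightarrow> bool" where
  "diffop_of_order n L \<longleftrightarrow>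
     (\<exists>a :: nat \<Rightarrow> complex poly. a n \<noteq> 0 \<and> (\<forall>f. L f = (\<Sum>i\<le>n. a i * (pderiv ^^ i) f)))"

text \<open>Here \<open>[:0, 1:]\<close> is \<open>x\<close> and \<open>[:-1, 1:]\<close> is \<open>x - 1\<close>.\<close>

definition D :: "nat \<Rightarrow> (nat \<Rightarrow> nat) \<Rightarrow> nat \<Rightarrow> (nat \<Rightarrow> nat) \<Rightarrow> nat \<Rightarrow> complex poly \<Rightarrow> complex poly" where
  "D r m i l k f =
     [:0, 1:] * [:-1, 1:] * pderiv f - of_int (e r m i l k) * [:-1, 1:] * f - of_nat (k + 1) * f"

definition partial_l :: "(nat \<Rightarrow> nat) \<Rightarrow> nat \<Rightarrow> nat \<Rightarrow> nat" where
  "partial_l j t = (\<lambda>i. \<Sum>s=1..t. one_vec (j s) i)"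

primrec D_comp :: "nat \<Rightarrow> (nat \<Rightarrow> nat) \<Rightarrow> (nat \<Rightarrow> nat) \<Rightarrow> nat \<Rightarrow> complex poly \<Rightarrow> complex poly" where
  "D_comp r m j 0 = id"
| "D_comp r m j (Suc t) = D r m (j (Suc t)) (partial_l j t) t \<circ> D_comp r m j t"

end

theory Submission
  imports Defs "HOL-Library.Multiset"
begin

text \<open>Put $o_i = i + m_1 + \dots + m_i$ and $d_i = l_i - l_{i+1}$, and for an integer $b$ consider
  the operator
  $$E_{k,b} = x(x-1)\frac{d}{dx} - (b+k)(x-1) - (k+1).$$
  Then $D_i(l,k) = E_{k,b}$ with $b = o_i - d_i$. In a product of the prescribed form, the
  factor that uses the index $i$ for the $(c+1)$-st time therefore has $b = o_i - c$, so
  the numbers $b$ of all factors form the blocks $o_i, o_i - 1, \dots, o_i - d_i + 1$, in an order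
  that depends on the sequence $j$. Since $E_{k+1,b} E_{k,c}$ is symmetric in $b$ and $c$
  (\<open>raise_op_commute\<close>), the order does not matter: all sequences $j$ give the same
  operator $L$.

  That $L$ maps $V(0,0)$, the span of the $x^{o_i}$, onto $V(l,k)$ is seen on the generators
  $F_i = L x^{o_i}$. Consistency says that the blocks $[o_i - d_i, o_i]$ are disjoint, and
  everything rests on this.

  \<^item> Acting on Laurent polynomials, $L$ annihilates $x^{b-1}(x-1)$ for each of these $b$. So $L x^b = L x^{b-1}$,
    and $F_i = L x^{o_i} = L x^{o_i-d_i}$. The first expression shows that $F_i$ vanishes at
    $0$ to order exactly $o_i$, the second one that its degree is exactly
    $o_i - d_i + k = e_i$ (\<open>order_0_gen\<close>, \<open>degree_gen\<close>).

  \<^item> If $p$ vanishes at $1$, then $L p$ vanishes there to order at least $k+1$. It cannot vanish to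
    order more than $k+r$ when $p \neq 0$ is a combination of the $x^{o_i}$: otherwise
    $p - (x-1)q$, for some combination $q$ of the $x^{b-1}$, would vanish at $1$ to order at least
    $k+r+1$. But its monomials lie in the $k+r+1$ places of the blocks, and a non-zero
    polynomial with $N$ monomials vanishes at $1$ to order less than $N$
    (\<open>lacunary_eq_0\<close>, \<open>raise_ops_nondegenerate_at_1\<close>).

  \<^item> Any space $W$ with the exponents of $V(l,k)$ contains, by a dimension count, non-zero $f_i$ of
    order at least $o_i$ at $0$ and of degree at most $e_i$, and all elements of $W$ with equal
    value at $1$ agree modulo $(x-1)^{k+1}$. The differences of suitably normalised $f_i$ and $F_i$ solve
    a homogeneous Hermite--Pade problem at $1$ for the powers $x^{-o_i}$, which has only the
    zero solution by the same bound on lacunary polynomials (\<open>congruent_family_eq_0\<close>). Hence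
    $W$ contains all $F_i$, and $W = L V(0,0)$.\<close>

section \<open>Degrees and orders of vanishing in a space of polynomials\<close>

text \<open>Degree and order of vanishing are treated together, the order with a negative sign: in
  both cases smaller values are what cancelling leading terms produces. The two axioms are
  what Gaussian elimination uses.\<close>

locale leading_grade =
  fixes v :: "complex poly \<Rightarrow> int"
  assumes subspace_below: "poly_vs.subspace {f. f = 0 \<or> v f < s}"
    and cancel_leading: "\<lbrakk>f \<noteq> 0; g \<noteq> 0; v f = v g\<rbrakk> \<Longrightarrow>
      \<exists>c. f - smult c g = 0 \<or> v (f - smult c g) < v f"
begin

text \<open>In a vanishing linear combination the term of the largest grade could be expressed through
  terms of smaller grade.\<close>

lemma independent_if_inj:
  assumes "inj_on v B" "0 \<notin> B"
  shows "poly_vs.independent B"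
proof
  assume "poly_vs.dependent B"
  then obtain t u where t: "finite t" "t \<subseteq> B" "(\<Sum>b\<in>t. smult (u b) b) = 0" "\<exists>b\<in>t. u b \<noteq> 0"
    unfolding poly_vs.dependent_explicit by blast
  define T where "T = {b\<in>t. u b \<noteq> 0}"
  have T: "finite T" "T \<noteq> {}" "T \<subseteq> B" using t by (auto simp: T_def)
  have sT: "(\<Sum>b\<in>T. smult (u b) b) = 0"
    using t(1,3) by (subst t(3)[symmetric], intro sum.mono_neutral_left) (auto simp: T_def)
  have "Max (v ` T) \<in> v ` T" using T by (intro Max_in) auto
  then obtain b0 where b0: "b0 \<in> T" "v b0 = Max (v ` T)" by force
  let ?S = "{f. f = 0 \<or> v f < v b0}"
  have "b \<in> ?S" if "b \<in> T - {b0}" for b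
  proof -
    have "v b \<le> v b0" using b0 that T by simp
    moreover have "v b \<noteq> v b0"
      using inj_onD[OF assms(1), of b b0] that b0(1) T(3) by blast
    ultimately show ?thesis by simp
  qed
  then have "(\<Sum>b\<in>T - {b0}. smult (u b) b) \<in> ?S"
    by (intro poly_vs.subspace_sum[OF subspace_below] poly_vs.subspace_scale[OF subspace_below])
  moreover have "(\<Sum>b\<in>T - {b0}. smult (u b) b) = smult (- u b0) b0"
    using sum.remove[OF T(1) b0(1), of "\<lambda>b. smult (u b) b"] sT
    by (simp add: add_eq_0_iff)
  ultimately have "smult (- u b0) b0 \<in> ?S" by (simp only:)
  from poly_vs.subspace_scale[OF subspace_below this, of "- 1 / u b0"]
  have "smult (- 1 / u b0) (smult (- u b0) b0) \<in> ?S" .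
  moreover have "u b0 \<noteq> 0" using b0 by (simp add: T_def)
  ultimately have "b0 \<in> ?S" by simp
  then show False using b0 T assms(2) by auto
qed

text \<open>An element of \<open>W\<close> is reduced by elements of \<open>B\<close> of its own grade; since only
  finitely many grades occur, this ends with \<open>0\<close>.\<close>

lemma span_eq_if_grades:
  assumes W: "poly_vs.subspace W" and B: "B \<subseteq> W" "v ` (W - {0}) \<subseteq> v ` (B - {0})"
    and fin: "finite (v ` (W - {0}))"
  shows "poly_vs.span B = W"
proof (rule antisym)
  show "poly_vs.span B \<subseteq> W" using B(1) W by (rule poly_vs.span_minimal)
  have "f \<in> poly_vs.span B" if "f \<in> W" for f
    using that
  proof (induction "card {s \<in> v ` (W - {0}). s < v f}" arbitrary: f rule: less_induct)
    case less
    show ?case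
    proof (cases "f = 0")
      case True
      then show ?thesis by (simp add: poly_vs.span_zero)
    next
      case False
      then have "v f \<in> v ` (B - {0})" using less.prems B(2) by auto
      then obtain b where b: "b \<in> B" "b \<noteq> 0" "v f = v b" by auto
      obtain c where c: "f - smult c b = 0 \<or> v (f - smult c b) < v f"
        using cancel_leading[OF False b(2,3)] by blast
      have mem: "smult c b \<in> poly_vs.span B"
        using b by (intro poly_vs.span_scale poly_vs.span_base)
      have gW: "f - smult c b \<in> W"
        using less.prems b B W by (metis poly_vs.subspace_diff poly_vs.subspace_scale subsetD)
      have "f - smult c b \<in> poly_vs.span B"
      proof (cases "f - smult c b = 0")
        case True
        then show ?thesis by (simp add: poly_vs.span_zero)
      next
        case nz: False
        then have lt: "v (f - smult c b) < v f" using c by simp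
        have "{s \<in> v ` (W - {0}). s < v (f - smult c b)} \<subset> {s \<in> v ` (W - {0}). s < v f}"
          using lt gW nz by (intro psubsetI) auto
        then have "card {s \<in> v ` (W - {0}). s < v (f - smult c b)} < card {s \<in> v ` (W - {0}). s < v f}"
          using fin by (intro psubset_card_mono) auto
        then show ?thesis using less.hyps gW by blast
      qed
      then show ?thesis using poly_vs.span_add[OF _ mem] by fastforce
    qed
  qed
  then show "W \<subseteq> poly_vs.span B" by blast
qed

theorem card_grades_eq_dim:
  assumes W: "poly_vs.subspace W" and T: "finite T" "W \<subseteq> poly_vs.span T"
  shows "finite (v ` (W - {0}))" "card (v ` (W - {0})) = poly_vs.dim W"
proof -
  obtain B where B: "B \<subseteq> W - {0}" "inj_on v B" "v ` B = v ` (W - {0})"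
    using subset_image_inj[of "v ` (W - {0})" v "W - {0}"] by auto
  have ind: "poly_vs.independent B" using B by (intro independent_if_inj) auto
  have "finite B"
    using poly_vs.independent_span_bound[OF T(1) ind] B(1) T(2) by blast
  then show fin: "finite (v ` (W - {0}))" using B(3) by (metis finite_imageI)
  have "poly_vs.span B = W"
    using B fin by (intro span_eq_if_grades W) auto
  then have "poly_vs.dim W = card B"
    using poly_vs.dim_span_eq_card_independent[OF ind] by simp
  also have "\<dots> = card (v ` (W - {0}))" using B by (metis card_image)
  finally show "card (v ` (W - {0})) = poly_vs.dim W" by simp
qed

lemma span_distinct_grades:
  assumes "finite B" "inj_on v B" "0 \<notin> B"
  shows "poly_vs.dim (poly_vs.span B) = card B" "v ` (poly_vs.span B - {0}) = v ` B"
proof -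
  show dim: "poly_vs.dim (poly_vs.span B) = card B"
    using assms by (intro poly_vs.dim_span_eq_card_independent independent_if_inj)
  note g = card_grades_eq_dim[OF poly_vs.subspace_span assms(1) subset_refl]
  have "v ` B \<subseteq> v ` (poly_vs.span B - {0})"
    using assms(3) poly_vs.span_base by (intro image_mono) auto
  then show "v ` (poly_vs.span B - {0}) = v ` B"
    using g dim assms by (metis card_image card_subset_eq)
qed

end

interpretation degree_grade: leading_grade "\<lambda>f. int (degree f)"
proof
  fix s
  show "poly_vs.subspace {f::complex poly. f = 0 \<or> int (degree f) < s}"
  proof (rule poly_vs.subspaceI)
    fix f g :: "complex poly"
    assume "f \<in> {f. f = 0 \<or> int (degree f) < s}" "g \<in> {f. f = 0 \<or> int (degree f) < s}"
    then show "f + g \<in> {f. f = 0 \<or> int (degree f) < s}"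
      using degree_add_le_max[of f g] by auto
  qed auto
next
  fix f g :: "complex poly"
  assume *: "f \<noteq> 0" "g \<noteq> 0" "int (degree f) = int (degree g)"
  let ?c = "lead_coeff f / lead_coeff g"
  have "f - smult ?c g = 0 \<or> degree (f - smult ?c g) < degree f"
  proof (cases "f - smult ?c g = 0")
    case False
    have "degree (f - smult ?c g) \<le> degree f"
      using * by (intro degree_diff_le) auto
    moreover have "coeff (f - smult ?c g) (degree f) = 0"
      using * by simp
    ultimately show ?thesis
      using False by (metis leading_coeff_0_iff le_less)
  qed simp
  then show "\<exists>c. f - smult c g = 0 \<or> int (degree (f - smult c g)) < int (degree f)" by auto
qed

lemma order_ge_iff_dvd: "f = 0 \<or> n \<le> order a f \<longleftrightarrow> [:-a, 1:] ^ n dvd (f :: complex poly)"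
  by (metis dvd_0_right order_divides)

interpretation order_grade: leading_grade "\<lambda>f. - int (order a f)" for a
proof
  fix s
  have "{f. f = 0 \<or> - int (order a f) < s} = {f. [:-a, 1:] ^ nat (1 - s) dvd f}"
  proof (rule Collect_cong)
    fix f :: "complex poly"
    have "- int (order a f) < s \<longleftrightarrow> nat (1 - s) \<le> order a f" by linarith
    then show "f = 0 \<or> - int (order a f) < s \<longleftrightarrow> [:-a, 1:] ^ nat (1 - s) dvd f"
      using order_ge_iff_dvd by metis
  qed
  then show "poly_vs.subspace {f. f = 0 \<or> - int (order a f) < s}"
    by (auto intro!: poly_vs.subspaceI dvd_add dvd_smult)
next
  fix f g :: "complex poly"
  assume nz: "f \<noteq> 0" "g \<noteq> 0" and eq: "- int (order a f) = - int (order a g)"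
  let ?n = "order a f"
  obtain p where p: "f = [:-a, 1:] ^ ?n * p" using order_1 by (metis dvdE)
  obtain q where q: "g = [:-a, 1:] ^ ?n * q" using order_1[of a g] eq by (auto elim!: dvdE)
  have q0: "poly q a \<noteq> 0"
  proof
    assume "poly q a = 0"
    then have "[:-a, 1:] ^ ?n * [:-a, 1:] dvd g"
      unfolding q by (intro mult_dvd_mono) (simp_all add: poly_eq_0_iff_dvd)
    then show False
      using order_2[OF nz(2), of a] eq by (simp only: power_Suc2 of_nat_eq_iff neg_equal_iff_equal)
  qed
  let ?c = "poly p a / poly q a"
  have "[:-a, 1:] dvd p - smult ?c q"
    using q0 by (simp add: poly_eq_0_iff_dvd[symmetric])
  then have "[:-a, 1:] ^ Suc ?n dvd [:-a, 1:] ^ ?n * (p - smult ?c q)"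
    by (metis dvd_refl mult_dvd_mono power_Suc2)
  also have "[:-a, 1:] ^ ?n * (p - smult ?c q) = f - smult ?c g"
    by (subst (2) p, subst q) (simp add: right_diff_distrib)
  finally have "f - smult ?c g = 0 \<or> Suc ?n \<le> order a (f - smult ?c g)"
    using order_ge_iff_dvd by blast
  then show "\<exists>c. f - smult c g = 0 \<or> - int (order a (f - smult c g)) < - int (order a f)"
    by (intro exI[of _ ?c]) auto
qed

lemma card_orders_eq_dim:
  assumes "poly_vs.subspace W" "finite T" "W \<subseteq> poly_vs.span T"
  shows "finite (order a ` (W - {0}))" "card (order a ` (W - {0})) = poly_vs.dim W"
proof -
  have "(\<lambda>f. - int (order a f)) ` (W - {0}) = (\<lambda>n. - int n) ` order a ` (W - {0})"
    by (simp add: image_image)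
  moreover have inj: "inj_on (\<lambda>n. - int n) S" for S by (rule inj_onI) simp
  ultimately show "finite (order a ` (W - {0}))" "card (order a ` (W - {0})) = poly_vs.dim W"
    using order_grade.card_grades_eq_dim[OF assms, of a] by (simp_all add: finite_image_iff card_image)
qed

lemma span_distinct_orders:
  assumes I: "finite I" and inj: "inj_on (\<lambda>i. order a (F i)) I" and nz: "\<And>i. i \<in> I \<Longrightarrow> F i \<noteq> 0"
  shows "poly_vs.dim (poly_vs.span (F ` I)) = card I"
    and "order a ` (poly_vs.span (F ` I) - {0}) = (\<lambda>i. order a (F i)) ` I"
proof -
  have F: "inj_on F I" using inj by (auto simp: inj_on_def)
  have "inj_on (\<lambda>f. - int (order a f)) (F ` I)" "0 \<notin> F ` I"
    using inj nz by (auto simp: inj_on_def)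
  note * = order_grade.span_distinct_grades[OF _ this]
  show "poly_vs.dim (poly_vs.span (F ` I)) = card I"
    using *(1) I by (simp add: card_image[OF F])
  have "(\<lambda>n. nat (- n)) ` (\<lambda>f. - int (order a f)) ` (poly_vs.span (F ` I) - {0}) =
      (\<lambda>n. nat (- n)) ` (\<lambda>f. - int (order a f)) ` (F ` I)"
    using *(2) I by simp
  then show "order a ` (poly_vs.span (F ` I) - {0}) = (\<lambda>i. order a (F i)) ` I"
    by (simp add: image_image)
qed

lemma span_distinct_degrees:
  assumes I: "finite I" and inj: "inj_on (\<lambda>i. degree (F i)) I" and nz: "\<And>i. i \<in> I \<Longrightarrow> F i \<noteq> 0"
  shows "poly_vs.dim (poly_vs.span (F ` I)) = card I"
    and "(\<lambda>f. int (degree f)) ` (poly_vs.span (F ` I) - {0}) = (\<lambda>i. int (degree (F i))) ` I"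
proof -
  have F: "inj_on F I" using inj by (auto simp: inj_on_def)
  have "inj_on (\<lambda>f. int (degree f)) (F ` I)" "0 \<notin> F ` I"
    using inj nz by (auto simp: inj_on_def)
  note * = degree_grade.span_distinct_grades[OF _ this]
  show "poly_vs.dim (poly_vs.span (F ` I)) = card I"
    using *(1) I by (simp add: card_image[OF F])
  show "(\<lambda>f. int (degree f)) ` (poly_vs.span (F ` I) - {0}) = (\<lambda>i. int (degree (F i))) ` I"
    using *(2) I by (simp add: image_image)
qed

section \<open>Polynomials with few monomials\<close>

lemma order_0_eqI:
  assumes "coeff f n \<noteq> 0" "\<And>m. m < n \<Longrightarrow> coeff f m = 0"
  shows "order 0 f = n"
proof -
  have "f \<noteq> 0" using assms(1) by auto
  have "n \<le> order 0 f" "\<not> Suc n \<le> order 0 f"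
    unfolding monom_1_dvd_iff[OF \<open>f \<noteq> 0\<close>, symmetric] monom_1_dvd_iff' using assms by auto
  then show ?thesis by simp
qed

lemma coeff_span_monom:
  assumes "f \<in> poly_vs.span (monom 1 ` A)" "coeff f n \<noteq> 0"
  shows "n \<in> A"
proof -
  have "f \<in> {f. \<forall>n. coeff f n \<noteq> 0 \<longrightarrow> n \<in> A}"
    using assms(1)
  proof (rule poly_vs.span_minimal[THEN subsetD, rotated -1])
    show "poly_vs.subspace {f :: complex poly. \<forall>n. coeff f n \<noteq> 0 \<longrightarrow> n \<in> A}"
      by (rule poly_vs.subspaceI) (auto, metis add_cancel_right_right)
  qed (auto simp: coeff_monom split: if_splits)
  then show ?thesis using assms(2) by blast
qed

text \<open>Induction on the number of monomials: $x f' - a f$ loses the monomial $x^a$, while its order of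
  vanishing at $1$ is at most one less than that of $f$.\<close>

lemma lacunary_eq_0:
  assumes "finite A" "\<And>n. coeff f n \<noteq> 0 \<Longrightarrow> n \<in> A" "[:-1, 1:] ^ card A dvd (f :: complex poly)"
  shows "f = 0"
  using assms
proof (induction A arbitrary: f rule: finite_induct)
  case empty
  then show ?case by (auto simp: poly_eq_iff)
next
  case (insert a A)
  obtain h where h: "f = [:-1, 1:] ^ Suc (card A) * h"
    using insert.prems(2) insert.hyps by (auto simp del: power_Suc elim!: dvdE)
  define g where "g = [:0, 1:] * pderiv f - smult (of_nat a) f"
  have coeff_g: "coeff g n = (of_nat n - of_nat a) * coeff f n" for n
    by (cases n) (simp_all add: g_def coeff_pderiv algebra_simps)
  have "[:-1, 1:] ^ card A dvd pderiv f"
    unfolding h pderiv_mult pderiv_power_Suc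
    by (intro dvd_add dvd_mult2[OF le_imp_power_dvd] dvd_mult[OF dvd_mult2[OF dvd_smult]]) simp_all
  moreover have "[:-1, 1:] ^ card A dvd f"
    unfolding h by (intro dvd_mult2 le_imp_power_dvd) simp
  ultimately have "[:-1, 1:] ^ card A dvd g"
    unfolding g_def by (intro dvd_diff dvd_mult dvd_smult)
  then have "g = 0"
    using insert.prems(1) coeff_g by (intro insert.IH) auto
  then have "coeff f n = 0" if "n \<noteq> a" for n
    using that coeff_g[of n] by simp
  then have f: "f = monom (coeff f a) a"
    by (auto simp: poly_eq_iff coeff_monom)
  have "poly f 1 = 0" by (simp add: h)
  then show ?case using f by (metis monom_eq_0 mult.right_neutral poly_monom power_one)
qed

text \<open>There are as many orders as the dimension says, and by the previous lemma they are all less than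
  it. In other words, a combination of $N$ given powers of $x$ can be found with any prescribed
  order less than $N$ at $1$.\<close>

lemma orders_span_monom:
  assumes "finite A"
  shows "order 1 ` (poly_vs.span (monom 1 ` A) - {0}) = {..<card A}"
proof (rule card_subset_eq)
  let ?W = "poly_vs.span (monom 1 ` A)"
  have "poly_vs.dim ?W = card A"
    using assms by (intro span_distinct_degrees) (auto simp: inj_on_def degree_monom_eq)
  then show "card (order 1 ` (?W - {0})) = card {..<card A}"
    using card_orders_eq_dim(2)[OF poly_vs.subspace_span _ subset_refl, of "monom 1 ` A"] assms by simp
  show "order 1 ` (?W - {0}) \<subseteq> {..<card A}"
  proof (intro image_subsetI)
    fix f assume "f \<in> ?W - {0}"
    then have f: "f \<in> ?W" "f \<noteq> 0" by auto
    show "order 1 f \<in> {..<card A}"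
    proof (rule ccontr)
      assume "order 1 f \<notin> {..<card A}"
      then have "[:-1, 1:] ^ card A dvd f" using order_ge_iff_dvd[of f "card A" 1] by auto
      then show False using lacunary_eq_0[OF assms, of f] coeff_span_monom[OF f(1)] f(2) by blast
    qed
  qed
qed simp

section \<open>The first-order operators and their composites\<close>

text \<open>With $h = x^{b-1}(x-1)^{k+1}$ this operator is $f \mapsto x(x-1)\,h\,(f/h)'$. It is
  $D_i(l,k)$ with $b = e_i(l,k) - k$.\<close>

definition raise_op :: "nat \<Rightarrow> int \<Rightarrow> complex poly \<Rightarrow> complex poly" where
  "raise_op k b f = [:0, 1:] * [:-1, 1:] * pderiv f
     - of_int (b + int k) * [:-1, 1:] * f - of_nat (k + 1) * f"

text \<open>The head of the list acts last, so that the first parameter of the \<open>s\<close>-th operator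
  applied is \<open>s - 1\<close>.\<close>

primrec raise_ops :: "int list \<Rightarrow> complex poly \<Rightarrow> complex poly" where
  "raise_ops [] f = f"
| "raise_ops (b # bs) f = raise_op (length bs) b (raise_ops bs f)"

lemma raise_op_add: "raise_op k b (f + g) = raise_op k b f + raise_op k b g"
  by (simp add: raise_op_def pderiv_add algebra_simps)

lemma raise_op_smult: "raise_op k b (smult c f) = smult c (raise_op k b f)"
  by (simp add: raise_op_def pderiv_smult algebra_simps smult_add_right smult_diff_right)

lemma raise_op_diff: "raise_op k b (f - g) = raise_op k b f - raise_op k b g"
  by (simp add: raise_op_def pderiv_diff algebra_simps)

lemma raise_ops_add: "raise_ops bs (f + g) = raise_ops bs f + raise_ops bs g"
  by (induction bs) (simp_all add: raise_op_add)

lemma raise_ops_smult: "raise_ops bs (smult c f) = smult c (raise_ops bs f)"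
  by (induction bs) (simp_all add: raise_op_smult)

lemma raise_ops_diff: "raise_ops bs (f - g) = raise_ops bs f - raise_ops bs g"
  by (induction bs) (simp_all add: raise_op_diff)

lemma raise_ops_0: "raise_ops bs 0 = 0"
  using raise_ops_smult[of bs 0 0] by simp

lemma raise_op_commute:
  "raise_op (Suc k) b (raise_op k c f) = raise_op (Suc k) c (raise_op k b f)"
proof -
  define X Y :: "complex poly" where "X = [:0, 1:]" and "Y = [:-1, 1:]"
  have d: "pderiv X = 1" "pderiv Y = 1" by (simp_all add: X_def Y_def pderiv_pCons)
  have XY: "X = Y + 1" by (simp add: X_def Y_def one_pCons)
  have "pderiv (of_nat n :: complex poly) = 0" "pderiv (of_int z :: complex poly) = 0" for n z
    by (simp_all add: of_nat_poly of_int_poly)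
  then show ?thesis
    unfolding raise_op_def X_def[symmetric] Y_def[symmetric]
    by (simp add: pderiv_add pderiv_diff pderiv_mult d) (simp add: XY algebra_simps)
qed

lemma raise_ops_mset_cong:
  assumes "mset bs = mset cs"
  shows "raise_ops bs = raise_ops cs"
proof -
  have move: "raise_ops (u @ b # w) f = raise_ops (b # u @ w) f" for u b w f
    by (induction u) (simp_all add: raise_op_commute)
  have "raise_ops bs f = raise_ops cs f" for f
    using assms
  proof (induction bs arbitrary: cs)
    case (Cons b bs)
    then obtain u w where cs: "cs = u @ b # w"
      by (metis list.set_intros(1) set_mset_mset split_list)
    have "mset bs = mset (u @ w)" using Cons.prems cs by simp
    then have "raise_ops bs f = raise_ops (u @ w) f" "length bs = length (u @ w)"
      by (fact Cons.IH) (metis \<open>mset bs = mset (u @ w)\<close> mset_eq_length)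
    then show ?case using cs by (simp only: move raise_ops.simps)
  qed simp
  then show ?thesis by blast
qed

text \<open>Multiplication by a power of $x$ shifts all $b$. It replaces computations with negative powers of
  $x$, which the block of $o_0 = 0$ would otherwise require.\<close>

lemma raise_ops_shift:
  "raise_ops (map (\<lambda>b. b + int K) bs) (monom 1 K * f) = monom 1 K * raise_ops bs f"
proof (induction bs)
  case (Cons b bs)
  have shift: "raise_op k (b + int K) (monom 1 K * g) = monom 1 K * raise_op k b g" for k g
  proof (cases K)
    case (Suc n)
    have "[:0, 1:] * (monom (of_nat K) n :: complex poly) = of_nat K * monom 1 K"
      by (simp add: Suc monom_Suc of_nat_poly smult_monom)
    then have X: "[:0, 1:] * pderiv (monom 1 K) = (of_nat K * monom 1 K :: complex poly)"
      by (simp add: pderiv_monom Suc)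
    have "[:0, 1:] * [:-1, 1:] * pderiv (monom 1 K * g) =
      [:-1, 1:] * ([:0, 1:] * pderiv (monom 1 K)) * g + monom 1 K * ([:0, 1:] * [:-1, 1:] * pderiv g)"
      unfolding pderiv_mult by (simp only: algebra_simps)
    then show ?thesis
      unfolding raise_op_def X by (simp only: of_int_add of_int_of_nat_eq) (simp only: algebra_simps)
  qed (simp add: one_pCons[symmetric] monom_0)
  then show ?case using Cons by simp
qed (simp)

lemma coeff_raise_op_0: "coeff (raise_op k b f) 0 = of_int (b - 1) * coeff f 0"
  by (simp add: raise_op_def of_int_poly of_nat_poly coeff_mult algebra_simps)

lemma coeff_raise_op_Suc: "coeff (raise_op k b f) (Suc n) =
    of_int (int n - int k - b) * coeff f n + of_int (b - 1 - int (Suc n)) * coeff f (Suc n)"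
proof -
  have e: "[:0, 1:] * [:-1, 1:] * pderiv f = pCons 0 (pCons 0 (pderiv f) - pderiv f)"
    "of_int z * [:-1, 1:] * f = smult (of_int z) (pCons 0 f - f)" 
    "of_nat w * f = smult (of_nat w) f" for z w
    by (simp_all add: of_int_poly of_nat_poly algebra_simps smult_diff_right smult_add_right)
  show ?thesis
    unfolding raise_op_def e
    by (cases n) (simp_all add: coeff_pderiv algebra_simps)
qed

lemma poly_raise_ops_1:
  "poly (raise_ops bs f) 1 = (-1) ^ length bs * fact (length bs) * poly f 1"
  by (induction bs) (simp_all add: raise_op_def algebra_simps)

text \<open>The local form of the operator at $1$: on order $n$, it multiplies the leading coefficient by
  $n - (k+1)$.\<close>

lemma raise_op_power_mult:
  "raise_op k b ([:-1, 1:] ^ n * g) = [:-1, 1:] ^ n * (of_int (int n - int k - 1) * g + [:-1, 1:] *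
       (of_int (int n - b - int k) * g + [:0, 1:] * pderiv g))"
proof -
  define Y :: "complex poly" where "Y = [:-1, 1:]"
  have X: "[:0, 1:] = Y + 1" by (simp add: Y_def one_pCons)
  have "pderiv Y = 1" by (simp add: Y_def pderiv_pCons)
  then have dY: "Y * pderiv (Y ^ n) = of_nat n * Y ^ n"
    by (cases n) (simp_all add: pderiv_power_Suc of_nat_poly smult_add_left algebra_simps del: power_Suc,
        simp add: algebra_simps)
  have "raise_op k b (Y ^ n * g) = (Y + 1) * (Y * pderiv (Y ^ n)) * g + Y ^ n * ((Y + 1) * Y * pderiv g)
     - of_int (b + int k) * Y * (Y ^ n * g) - of_nat (k + 1) * (Y ^ n * g)"
    unfolding raise_op_def pderiv_mult X Y_def[symmetric] by (simp only: algebra_simps)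
  also have "\<dots> = Y ^ n * (of_int (int n - int k - 1) * g + Y *
       (of_int (int n - b - int k) * g + (Y + 1) * pderiv g))"
    unfolding dY by (simp add: algebra_simps)
  finally show ?thesis unfolding X Y_def .
qed

text \<open>The function $x^{b-1}(x-1)^{k+1}$, which $E_{k,b}$ annihilates, is mapped by $E_{k,c}$ to a multiple of the function
  annihilated by $E_{k+1,b}$. So $x^{b-1}(x-1)$, which $E_{0,b}$ annihilates, is annihilated by every
  composite in which $b$ occurs.\<close>

lemma raise_op_monom_power:
  assumes "b \<ge> 1"
  shows "raise_op k c (monom 1 (nat (b - 1)) * [:-1, 1:] ^ Suc k) =
    smult (of_int (b - c)) (monom 1 (nat (b - 1)) * [:-1, 1:] ^ Suc (Suc k))"
proof -
  obtain n where n: "b = 1 + int n" using assms by (metis zle_iff_zadd)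
  have M: "[:0, 1:] * pderiv (monom 1 n) = (of_nat n * monom 1 n :: complex poly)"
    by (cases n) (simp_all add: pderiv_monom monom_Suc[symmetric] of_nat_poly smult_monom)
  have "raise_op k c ([:-1, 1:] ^ Suc k * monom 1 n) =
      [:-1, 1:] ^ Suc k * ([:-1, 1:] * ((of_int (1 - c) + of_nat n) * monom 1 n))"
    unfolding raise_op_power_mult M
    by (simp add: algebra_simps del: mult_pCons_left mult_pCons_right power_Suc)
  also have "(of_int (1 - c) + of_nat n :: complex poly) = [:of_int (b - c):]"
    by (simp add: n of_int_poly of_nat_poly)
  finally show ?thesis
    by (simp add: n ac_simps del: mult_pCons_left mult_pCons_right) (simp add: ac_simps)
qed

lemma raise_ops_monom_power:
  assumes "b \<ge> 1"
  shows "raise_ops bs (monom 1 (nat (b - 1)) * [:-1, 1:]) =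
    smult (\<Prod>c\<leftarrow>bs. of_int (b - c)) (monom 1 (nat (b - 1)) * [:-1, 1:] ^ Suc (length bs))"
proof (induction bs)
  case (Cons c bs)
  then show ?case
    by (simp add: raise_op_smult raise_op_monom_power[OF assms] mult.commute[of "of_int b - of_int c"]
        del: power_Suc mult_pCons_left mult_pCons_right)
qed simp

lemma power_Suc_dvd_raise_op:
  assumes "[:-1, 1:] ^ Suc k dvd f"
  shows "[:-1, 1:] ^ Suc (Suc k) dvd raise_op k b f"
proof -
  obtain g where f: "f = [:-1, 1:] ^ Suc k * g" using assms by (metis dvdE)
  have "raise_op k b f = [:-1, 1:] ^ Suc (Suc k) *
      (of_int (int (Suc k) - b - int k) * g + [:0, 1:] * pderiv g)"
    unfolding f raise_op_power_mult power_Suc2[of _ "Suc k"] mult.assoc by simp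
  then show ?thesis by (metis dvd_triv_left)
qed

lemma power_dvd_raise_ops:
  assumes "[:-1, 1:] dvd f"
  shows "[:-1, 1:] ^ Suc (length bs) dvd raise_ops bs f"
  by (induction bs) (use assms power_Suc_dvd_raise_op in \<open>auto simp del: power_Suc simp: power_0\<close>)

text \<open>The factor $n - (k+1)$ vanishes only for $n = k+1$; all other orders are preserved.\<close>

lemma order_of_power_dvd_raise_op:
  assumes "[:-1, 1:] ^ N dvd raise_op k b f"
  shows "f = 0 \<or> order 1 f = Suc k \<or> N \<le> order 1 f"
proof (rule ccontr)
  assume *: "\<not> ?thesis"
  let ?\<nu> = "order 1 f"
  obtain g where g: "f = [:-1, 1:] ^ ?\<nu> * g" using order_1 by (metis dvdE)
  have "[:-1, 1:] ^ Suc ?\<nu> dvd raise_op k b f"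
    using assms * by (meson dvd_trans le_imp_power_dvd not_less_eq_eq)
  then have "[:-1, 1:] ^ ?\<nu> * [:-1, 1:] dvd [:-1, 1:] ^ ?\<nu> * (of_int (int ?\<nu> - int k - 1) * g + [:-1, 1:] *
       (of_int (int ?\<nu> - b - int k) * g + [:0, 1:] * pderiv g))"
    using raise_op_power_mult[of k b ?\<nu> g] g by (simp only: power_Suc2)
  then have "[:-1, 1:] dvd of_int (int ?\<nu> - int k - 1) * g + [:-1, 1:] *
       (of_int (int ?\<nu> - b - int k) * g + [:0, 1:] * pderiv g)"
    by (subst (asm) dvd_mult_cancel_left) simp
  then have "of_int (int ?\<nu> - int k - 1) * poly g 1 = 0"
    by (simp add: poly_eq_0_iff_dvd[symmetric])
  moreover have "(of_int (int ?\<nu> - int k - 1) :: complex) \<noteq> 0"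
    using * by (subst of_int_eq_0_iff) auto
  ultimately have "[:-1, 1:] dvd g" by (simp add: poly_eq_0_iff_dvd)
  then have "[:-1, 1:] ^ ?\<nu> * [:-1, 1:] dvd [:-1, 1:] ^ ?\<nu> * g" by (rule mult_dvd_mono[OF dvd_refl])
  then have "[:-1, 1:] ^ Suc ?\<nu> dvd f" using g by (simp only: power_Suc2)
  then show False using * order_2[of f 1] by blast
qed

text \<open>Modulo a high power of $x-1$, too, the kernel of the composite is spanned by the
  $x^{b-1}(x-1)$. The induction removes the operator applied last: by the previous lemma, what it
  maps to order at least $N$ has itself order at least $N$, up to a multiple of the function that it
  annihilates. As the $b$ are distinct, that function is, up to a non-zero factor, the image of
  $x^{b-1}(x-1)$ under the remaining operators.\<close>

lemma raise_ops_kernel_mod: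
  assumes "distinct bs" "\<forall>b\<in>set bs. b \<ge> 1" "length bs < N" "[:-1, 1:] ^ N dvd raise_ops bs f"
  shows "\<exists>q \<in> poly_vs.span ((\<lambda>b. monom 1 (nat (b - 1))) ` set bs). [:-1, 1:] ^ N dvd f - [:-1, 1:] * q"
  using assms
proof (induction bs arbitrary: f)
  case Nil
  then show ?case by (auto intro!: bexI[of _ 0])
next
  case (Cons b bs)
  let ?n = "Suc (length bs)" and ?x = "monom 1 (nat (b - 1)) :: complex poly"
  define z where "z = (\<Prod>c\<leftarrow>bs. of_int (b - c) :: complex)"
  have "z \<noteq> 0" using Cons.prems(1) by (auto simp: z_def prod_list_zero_iff)
  have h: "raise_ops bs (?x * [:-1, 1:]) = smult z (?x * [:-1, 1:] ^ ?n)"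
    using raise_ops_monom_power[of b bs] Cons.prems(2) by (simp add: z_def)
  let ?g = "raise_ops bs f"
  have E: "[:-1, 1:] ^ N dvd raise_op (length bs) b ?g" using Cons.prems by simp
  have "[:-1, 1:] ^ ?n dvd ?g"
    using order_of_power_dvd_raise_op[OF E] order_ge_iff_dvd[of ?g ?n 1] Cons.prems(3) by auto
  then obtain u where u: "?g = [:-1, 1:] ^ ?n * u" by (metis dvdE)
  define t where "t = poly u 1 / z"
  let ?f = "f - smult t (?x * [:-1, 1:])"
  have g': "raise_ops bs ?f = [:-1, 1:] ^ ?n * (u - smult (poly u 1) ?x)"
  proof -
    have "t * z = poly u 1" using \<open>z \<noteq> 0\<close> by (simp add: t_def)
    then show ?thesis
      unfolding raise_ops_diff raise_ops_smult h u right_diff_distrib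
      by (simp only: smult_smult mult_smult_right) (simp only: mult.commute)
  qed
  have "raise_op (length bs) b (?x * [:-1, 1:] ^ ?n) = 0"
    using raise_op_monom_power[of b "length bs" b] Cons.prems(2) by simp
  then have "raise_op (length bs) b (raise_ops bs ?f) = raise_op (length bs) b ?g"
    by (simp add: raise_ops_diff raise_ops_smult h raise_op_diff raise_op_smult
        del: power_Suc mult_pCons_left mult_pCons_right)
  moreover have "[:-1, 1:] dvd u - smult (poly u 1) ?x"
    by (simp add: poly_eq_0_iff_dvd[symmetric] poly_monom)
  then have "[:-1, 1:] ^ Suc ?n dvd raise_ops bs ?f"
    unfolding g' power_Suc2[of _ ?n] by (intro mult_dvd_mono) auto
  ultimately have "[:-1, 1:] ^ N dvd raise_ops bs ?f"
    using E order_of_power_dvd_raise_op[of N "length bs" b "raise_ops bs ?f"]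
      order_ge_iff_dvd[of "raise_ops bs ?f" "Suc ?n" 1] order_ge_iff_dvd[of "raise_ops bs ?f" N 1]
    by auto
  from Cons.IH[OF _ _ _ this] Cons.prems obtain q where
    q: "q \<in> poly_vs.span ((\<lambda>b. monom 1 (nat (b - 1))) ` set bs)" "[:-1, 1:] ^ N dvd ?f - [:-1, 1:] * q"
    by auto
  have "q + smult t ?x \<in> poly_vs.span ((\<lambda>b. monom 1 (nat (b - 1))) ` set (b # bs))"
    using q(1) by (intro poly_vs.span_add poly_vs.span_scale)
      (auto intro: poly_vs.span_base poly_vs.span_mono[THEN subsetD])
  moreover have "?f - [:-1, 1:] * q = f - [:-1, 1:] * (q + smult t ?x)"
    unfolding right_diff_distrib distrib_left mult_smult_right mult.commute[of "[:-1, 1:]" ?x] by simp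
  with q(2) have "[:-1, 1:] ^ N dvd f - [:-1, 1:] * (q + smult t ?x)" by (simp only:)
  ultimately show ?case by blast
qed

lemma prod_list_of_int_eq_0_iff:
  "(\<Prod>b\<leftarrow>bs. of_int (g b) :: complex) = 0 \<longleftrightarrow> (\<exists>b\<in>set bs. g b = 0)"
  by (induction bs) auto

text \<open>In $E_{k,b}\,x^n = (n-k-b)\,x^{n+1} + (b-1-n)\,x^n$ the second coefficient does not depend on $k$; in a
  composite, the first one is met at degree $n+k$, so that $k$ cancels there as well (next lemma).\<close>

lemma coeff_raise_ops_low:
  assumes "\<And>m. m < n \<Longrightarrow> coeff f m = 0"
  shows "m < n \<Longrightarrow> coeff (raise_ops bs f) m = 0"
    and "coeff (raise_ops bs f) n = (\<Prod>b\<leftarrow>bs. of_int (b - 1 - int n)) * coeff f n"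
proof -
  have "(\<forall>m<n. coeff (raise_ops bs f) m = 0) \<and>
      coeff (raise_ops bs f) n = (\<Prod>b\<leftarrow>bs. of_int (b - 1 - int n)) * coeff f n"
  proof (induction bs)
    case (Cons b bs)
    have "coeff (raise_ops (b # bs) f) m = 0" if "m < n" for m
      using Cons that by (cases m) (simp_all add: coeff_raise_op_0 coeff_raise_op_Suc)
    moreover have "coeff (raise_ops (b # bs) f) n =
        (\<Prod>b\<leftarrow>b # bs. of_int (b - 1 - int n)) * coeff f n"
      using Cons by (cases n) (simp_all add: coeff_raise_op_0 coeff_raise_op_Suc)
    ultimately show ?case by blast
  qed (use assms in simp)
  then show "m < n \<Longrightarrow> coeff (raise_ops bs f) m = 0"
    and "coeff (raise_ops bs f) n = (\<Prod>b\<leftarrow>bs. of_int (b - 1 - int n)) * coeff f n" by auto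
qed

lemma coeff_raise_ops_high:
  assumes "degree f \<le> n"
  shows "degree (raise_ops bs f) \<le> n + length bs"
    and "coeff (raise_ops bs f) (n + length bs) = (\<Prod>b\<leftarrow>bs. of_int (int n - b)) * coeff f n"
proof -
  have "(\<forall>m>n + length bs. coeff (raise_ops bs f) m = 0) \<and>
      coeff (raise_ops bs f) (n + length bs) = (\<Prod>b\<leftarrow>bs. of_int (int n - b)) * coeff f n"
  proof (induction bs)
    case Nil
    then show ?case using assms by (auto intro: coeff_eq_0)
  next
    case (Cons b bs)
    have "coeff (raise_ops (b # bs) f) m = 0" if "m > n + length (b # bs)" for m
      using Cons that by (cases m) (simp_all add: coeff_raise_op_Suc)
    moreover have "coeff (raise_ops (b # bs) f) (n + length (b # bs)) =
        (\<Prod>b\<leftarrow>b # bs. of_int (int n - b)) * coeff f n"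
      using Cons by (simp add: coeff_raise_op_Suc)
    ultimately show ?case by blast
  qed
  then show "degree (raise_ops bs f) \<le> n + length bs"
    and "coeff (raise_ops bs f) (n + length bs) = (\<Prod>b\<leftarrow>bs. of_int (int n - b)) * coeff f n"
    by (auto intro: degree_le)
qed

section \<open>The image of the monomials\<close>

text \<open>The common setting for the analysis of $L$ and of $V(l,k)$: \<open>ex i\<close> is $o_i$,
  \<open>bs\<close> lists the $b$ of the factors of $L$, and \<open>gap\<close> says that the block
  $[o_{i+1} - d_{i+1}, o_{i+1}]$ begins after $o_i$. The blocks here include their lower ends
  $o_i - d_i$, which do not belong to \<open>bs\<close>.\<close>

locale exponent_blocks =
  fixes r :: nat and ex d :: "nat \<Rightarrow> nat" and bs :: "int list"
  assumes gap: "i < r \<Longrightarrow> ex i + d (Suc i) < ex (Suc i)"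
    and set_bs: "set bs = {int (ex i) - int c | i c. i \<le> r \<and> c < d i}"
    and length_bs: "length bs = (\<Sum>i\<le>r. d i)"
begin

abbreviation "k \<equiv> length bs"

lemma block_apart: "i < j \<Longrightarrow> j \<le> r \<Longrightarrow> ex i + d j < ex j"
proof (induction j)
  case (Suc j)
  then show ?case using gap[of j] by (cases "i = j") auto
qed simp

lemma block_inj:
  assumes "int (ex i) - int c = int (ex j) - int c'" "i \<le> r" "j \<le> r" "c \<le> d i" "c' \<le> d j"
  shows "i = j" "c = c'"
proof -
  show "i = j" using assms block_apart[of i j] block_apart[of j i] by (cases i j rule: linorder_cases) auto
  then show "c = c'" using assms(1) by simp
qed

lemma d_le_k: "i \<le> r \<Longrightarrow> d i \<le> k"
  unfolding length_bs by (intro member_le_sum) auto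

lemma distinct_bs: "distinct bs"
proof (rule card_distinct)
  have "set bs = (\<lambda>(i, c). int (ex i) - int c) ` (SIGMA i:{..r}. {..<d i})"
    unfolding set_bs by force
  moreover have "inj_on (\<lambda>(i, c). int (ex i) - int c) (SIGMA i:{..r}. {..<d i})"
    using block_inj by (fastforce intro!: inj_onI)
  ultimately show "card (set bs) = k" by (simp add: card_image length_bs)
qed

lemma not_in_bs: "i \<le> r \<Longrightarrow> int (ex i) + 1 \<notin> set bs" "i \<le> r \<Longrightarrow> int (ex i) - int (d i) \<notin> set bs"
proof -
  assume i: "i \<le> r"
  show "int (ex i) + 1 \<notin> set bs"
  proof
    assume "int (ex i) + 1 \<in> set bs"
    then obtain j c where "int (ex i) + 1 = int (ex j) - int c" "j \<le> r" "c < d j"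
      unfolding set_bs by blast
    then show False using block_inj[of i 0 j "Suc c"] i by auto
  qed
  show "int (ex i) - int (d i) \<notin> set bs"
    unfolding set_bs using block_inj[of i "d i"] i by (auto dest: less_imp_le)
qed

definition gen :: "nat \<Rightarrow> complex poly" where "gen i = raise_ops bs (monom 1 (ex i))"

lemma coeff_gen_low: "m < ex i \<Longrightarrow> coeff (gen i) m = 0"
  unfolding gen_def by (rule coeff_raise_ops_low) (auto simp: coeff_monom)

lemma order_0_gen: "i \<le> r \<Longrightarrow> order 0 (gen i) = ex i"
proof (rule order_0_eqI)
  assume i: "i \<le> r"
  have "coeff (gen i) (ex i) = (\<Prod>b\<leftarrow>bs. of_int (b - 1 - int (ex i)))"
    unfolding gen_def by (subst coeff_raise_ops_low) (auto simp: coeff_monom)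
  also have "\<dots> \<noteq> 0"
    using not_in_bs(1)[OF i] unfolding prod_list_of_int_eq_0_iff
    by (metis add.commute add_diff_cancel_right' diff_add_cancel diff_diff_eq add_0)
  finally show "coeff (gen i) (ex i) \<noteq> 0" .
qed (simp add: coeff_gen_low)

lemma poly_gen_1: "poly (gen i) 1 = (-1) ^ k * fact k"
  by (simp add: gen_def poly_raise_ops_1 poly_monom)

lemma gen_nonzero: "gen i \<noteq> 0"
  using poly_gen_1[of i] by auto

text \<open>As $d_i \le k$ for all $i$, a shift by $k$ makes all $b$ positive.\<close>

definition shifted :: "int list" where "shifted = map (\<lambda>b. b + int k) bs"

lemma shifted:
  "length shifted = k" "distinct shifted" "\<forall>b\<in>set shifted. 1 \<le> b"
  "set shifted = (\<lambda>b. b + int k) ` set bs"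
  "raise_ops shifted (monom 1 k * f) = monom 1 k * raise_ops bs f"
  using distinct_bs d_le_k unfolding shifted_def raise_ops_shift
  by (force simp: distinct_map set_bs)+

text \<open>Each $x^b - x^{b-1}$ with $b$ in the list is in the kernel, so the image of a power of $x$ does not
  change when the exponent moves down through a block.\<close>

lemma raise_ops_block:
  assumes "i \<le> r" "c \<le> d i"
  shows "raise_ops shifted (monom 1 (ex i + k - c)) = raise_ops shifted (monom 1 (ex i + k))"
  using assms(2)
proof (induction c)
  case (Suc c)
  let ?b = "int (ex i) - int c + int k"
  have k: "c < k" using Suc.prems d_le_k[OF assms(1)] by simp
  have "int (ex i) - int c \<in> set bs"
    unfolding set_bs using Suc.prems assms(1) Suc_le_lessD by blast
  then have b: "?b \<in> set shifted" "1 \<le> ?b" "nat (?b - 1) = ex i + k - Suc c"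
    using k by (auto simp: shifted(4))
  have "(\<Prod>c\<leftarrow>shifted. of_int (?b - c) :: complex) = 0"
    unfolding prod_list_of_int_eq_0_iff using b(1) by (intro bexI[of _ ?b]) simp_all
  then have "raise_ops shifted (monom 1 (ex i + k - Suc c) * [:-1, 1:]) = 0"
    using raise_ops_monom_power[OF b(2), of shifted] b(3) by simp
  moreover have "monom 1 (ex i + k - Suc c) * [:-1, 1:] =
      (monom 1 (ex i + k - c) - monom 1 (ex i + k - Suc c) :: complex poly)"
  proof -
    have "ex i + k - c = Suc (ex i + k - Suc c)" using k by simp
    then show ?thesis by (simp only: monom_Suc) simp
  qed
  ultimately show ?case using Suc by (simp add: raise_ops_diff)
qed simp

text \<open>On $x^{o_i}$ the top coefficients of the composite vanish $d_i$ times in a row and do not show the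
  degree. At the lower end $o_i - d_i$ of the block, which is not in the list, the top
  coefficient is non-zero, and the image is the same.\<close>

lemma degree_gen:
  assumes "i \<le> r"
  shows "degree (gen i) + d i = ex i + k"
proof -
  let ?n = "ex i + k - d i"
  have dk: "d i \<le> k" using d_le_k assms .
  let ?g = "raise_ops shifted (monom 1 ?n)"
  have "coeff ?g (?n + k) = (\<Prod>b\<leftarrow>shifted. of_int (int ?n - b))"
    using coeff_raise_ops_high(2)[of "monom 1 ?n" ?n shifted]
    by (simp add: shifted(1) degree_monom_le)
  also have "\<dots> \<noteq> 0"
    using not_in_bs(2)[OF assms] dk
    unfolding prod_list_of_int_eq_0_iff shifted(4)
    by (auto simp: algebra_simps)
  finally have "?n + k \<le> degree ?g" by (rule le_degree)
  moreover have "degree ?g \<le> ?n + k"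
    using coeff_raise_ops_high(1)[of "monom 1 ?n" ?n shifted]
    by (simp add: shifted(1) degree_monom_le)
  moreover have "?g = monom 1 k * gen i"
    unfolding raise_ops_block[OF assms order_refl] gen_def shifted(5)[symmetric]
    by (simp add: mult_monom add.commute)
  then have "degree ?g = k + degree (gen i)"
    using gen_nonzero by (simp add: degree_mult_eq degree_monom_eq)
  ultimately show ?thesis using dk by simp
qed

text \<open>By \<open>raise_ops_kernel_mod\<close>, $p$ agrees with some $(x-1)q$ up to order $k+r+1$ at $1$, and the
  exponents of $p - (x-1)q$ lie in the blocks, which have $k+r+1$ elements in all. So
  $p = (x-1)q$. If $q \neq 0$, its lowest exponent would also be an exponent of $p$, that is, one of
  the $o_i$; but it is some $b - 1$, which is not the upper end of a block.\<close>

lemma raise_ops_nondegenerate_at_1: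
  assumes p: "p \<in> poly_vs.span (monom 1 ` ex ` {..r})"
    and dvd: "[:-1, 1:] ^ (k + r + 1) dvd raise_ops bs p"
  shows "p = 0"
proof -
  let ?p = "monom 1 k * p" and ?A = "(\<lambda>(i, c). ex i + k - c) ` (SIGMA i:{..r}. {..d i})"
  have "[:-1, 1:] ^ (k + r + 1) dvd raise_ops shifted ?p"
    unfolding shifted(5) using dvd by (rule dvd_mult)
  then obtain q where q: "q \<in> poly_vs.span (monom 1 ` (\<lambda>b. nat (b - 1)) ` set shifted)"
      "[:-1, 1:] ^ (k + r + 1) dvd ?p - [:-1, 1:] * q"
    using raise_ops_kernel_mod[of shifted "k + r + 1" ?p] shifted by (auto simp: image_image)
  have p_supp: "\<exists>i\<le>r. n = ex i + k" if "coeff ?p n \<noteq> 0" for n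
  proof -
    have "k \<le> n" "coeff p (n - k) \<noteq> 0" using that by (auto simp: coeff_monom_mult split: if_splits)
    then show ?thesis using coeff_span_monom[OF p, of "n - k"] by force
  qed
  have q_supp: "\<exists>i\<le>r. \<exists>c<d i. n + Suc c = ex i + k" if n: "coeff q n \<noteq> 0" for n
  proof -
    obtain i c where "i \<le> r" "c < d i" "n = nat (int (ex i) - int c + int k - 1)"
      using coeff_span_monom[OF q(1) n] unfolding shifted(4) set_bs by auto
    then show ?thesis using d_le_k[of i] by (intro exI[of _ i] conjI exI[of _ c]) auto
  qed
  have "?p - [:-1, 1:] * q = 0"
  proof (rule lacunary_eq_0)
    show "finite ?A" by simp
    have "card ?A \<le> card (SIGMA i:{..r}. {..d i})" by (rule card_image_le) simp
    also have "\<dots> = k + r + 1" by (simp add: length_bs sum.distrib sum_Suc)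
    finally show "[:-1, 1:] ^ card ?A dvd ?p - [:-1, 1:] * q" using q(2) by (rule power_le_dvd[rotated])
    show "n \<in> ?A" if n: "coeff (?p - [:-1, 1:] * q) n \<noteq> 0" for n
    proof -
      have "[:-1, 1:] * q = pCons 0 q - q" by simp
      then have "coeff ?p n \<noteq> 0 \<or> coeff q n \<noteq> 0 \<or> (\<exists>m. n = Suc m \<and> coeff q m \<noteq> 0)"
        using n by (cases n) auto
      then have "\<exists>i\<le>r. \<exists>c\<le>d i. n + c = ex i + k"
      proof (elim disjE exE conjE)
        assume "coeff ?p n \<noteq> 0"
        then show ?thesis using p_supp[of n] by (metis add.right_neutral le0)
      next
        assume "coeff q n \<noteq> 0"
        then show ?thesis using q_supp[of n] by (metis Suc_leI)
      next
        fix m assume "n = Suc m" "coeff q m \<noteq> 0"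
        then show ?thesis using q_supp[of m] by (metis add_Suc_shift less_imp_le)
      qed
      then obtain i c where "i \<le> r" "c \<le> d i" "n + c = ex i + k" by blast
      then show ?thesis by (intro rev_image_eqI[of "(i, c)"]) auto
    qed
  qed
  then have pq: "?p = pCons 0 q - q" by simp
  have "q = 0"
  proof (rule ccontr)
    assume "q \<noteq> 0"
    define n where "n = order 0 q"
    have "coeff q n \<noteq> 0" "\<And>m. m < n \<Longrightarrow> coeff q m = 0"
      using \<open>q \<noteq> 0\<close> monom_1_dvd_iff[OF \<open>q \<noteq> 0\<close>, of n] monom_1_dvd_iff[OF \<open>q \<noteq> 0\<close>, of "Suc n"]
      unfolding monom_1_dvd_iff' n_def by (auto simp: less_Suc_eq)
    then have "coeff ?p n \<noteq> 0" unfolding pq by (cases n) auto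
    then obtain i where i: "i \<le> r" "n = ex i + k" using p_supp by blast
    obtain j c where "j \<le> r" "c < d j" "n + Suc c = ex j + k" using q_supp \<open>coeff q n \<noteq> 0\<close> by blast
    then show False using block_inj[of i 0 j "Suc c"] i by auto
  qed
  then show "p = 0" using pq by simp
qed

end

section \<open>The space with the given exponents\<close>

lemma power_dvd_iff_cancel_monom:
  "[:-1, 1:] ^ n dvd monom 1 m * (f :: complex poly) \<longleftrightarrow> [:-1, 1:] ^ n dvd f"
proof (cases "f = 0")
  case False
  then have "order 1 (monom 1 m * f) = order 1 f"
    by (subst order_mult) (simp_all add: order_0I poly_monom)
  then show ?thesis using False order_ge_iff_dvd[of f n 1] order_ge_iff_dvd[of "monom 1 m * f" n 1] by simp
qed simp

context exponent_blocks
begin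

text \<open>The defining property of $V(l,k)$, in terms of $o_i$ and $d_i$.\<close>

definition admissible :: "complex poly set \<Rightarrow> bool" where
  "admissible W \<longleftrightarrow> poly_vs.subspace W \<and> poly_vs.dim W = r + 1 \<and>
     (\<lambda>f. int (degree f)) ` (W - {0}) = (\<lambda>i. int k + int (ex i) - int (d i)) ` {0..r} \<and>
     order 0 ` (W - {0}) = ex ` {0..r} \<and>
     order 1 ` (W - {0}) = insert 0 {k + 1..k + r}"

definition gens :: "complex poly set" where "gens = poly_vs.span (gen ` {0..r})"

lemma gens_eq_image: "gens = raise_ops bs ` poly_vs.span (monom 1 ` ex ` {0..r})"
proof -
  have "module_hom (smult :: complex \<Rightarrow> _) smult (raise_ops bs)"
    unfolding module_hom_iff using poly_vs.module_axioms by (simp add: raise_ops_add raise_ops_smult)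
  from module_hom.span_image[OF this, of "monom 1 ` ex ` {0..r}"] show ?thesis
    by (simp add: gens_def image_image gen_def)
qed

lemma inj_ex: "inj_on ex {0..r}"
  using block_inj[of _ 0 _ 0] by (auto intro!: inj_onI)

lemma dim_gens: "poly_vs.dim gens = r + 1"
  and orders_0_gens: "order 0 ` (gens - {0}) = ex ` {0..r}"
proof -
  have "inj_on (\<lambda>i. order 0 (gen i)) {0..r}"
    using inj_ex by (auto simp: inj_on_def order_0_gen)
  note * = span_distinct_orders[OF _ this gen_nonzero]
  show "poly_vs.dim gens = r + 1" "order 0 ` (gens - {0}) = ex ` {0..r}"
    using * image_cong[OF refl order_0_gen, of "{0..r}"] by (simp_all add: gens_def)
qed

lemma int_degree_gen: "i \<le> r \<Longrightarrow> int (degree (gen i)) = int k + int (ex i) - int (d i)"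
  using degree_gen[of i] by linarith

lemma degree_gen_mono: "i < j \<Longrightarrow> j \<le> r \<Longrightarrow> degree (gen i) < degree (gen j)"
  using degree_gen[of i] degree_gen[of j] block_apart[of i j] by simp

lemma degrees_gens: "(\<lambda>f. int (degree f)) ` (gens - {0}) = (\<lambda>i. int k + int (ex i) - int (d i)) ` {0..r}"
proof -
  have "inj_on (\<lambda>i. degree (gen i)) {0..r}"
    using degree_gen_mono by (intro linorder_inj_onI) force+
  from span_distinct_degrees(2)[OF _ this gen_nonzero] show ?thesis
    using image_cong[OF refl int_degree_gen, of "{0..r}"] by (simp add: gens_def)
qed

lemma gen_cong_mod: "[:-1, 1:] ^ Suc k dvd gen i - gen j"
proof -
  have "[:-1, 1:] dvd monom 1 (ex i) - (monom 1 (ex j) :: complex poly)"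
    by (simp add: poly_eq_0_iff_dvd[symmetric] poly_monom)
  then show ?thesis
    unfolding gen_def raise_ops_diff[symmetric] by (rule power_dvd_raise_ops)
qed

text \<open>All orders other than $0$ lie in $[k+1,k+r]$, and there must be $r+1$ orders in all.\<close>

lemma orders_1_gens: "order 1 ` (gens - {0}) = insert 0 {k + 1..k + r}"
proof (rule card_subset_eq)
  have "card (order 1 ` (gens - {0})) = poly_vs.dim gens"
    unfolding gens_def by (rule card_orders_eq_dim(2)[OF poly_vs.subspace_span _ subset_refl]) simp
  then show "card (order 1 ` (gens - {0})) = card (insert 0 {k + 1..k + r})"
    by (simp add: dim_gens)
  show "order 1 ` (gens - {0}) \<subseteq> insert 0 {k + 1..k + r}"
  proof (intro image_subsetI)
    fix f assume "f \<in> gens - {0}"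
    then obtain p where p: "p \<in> poly_vs.span (monom 1 ` ex ` {..r})" "f = raise_ops bs p" "f \<noteq> 0"
      by (auto simp: gens_eq_image atLeast0AtMost)
    have "p \<noteq> 0" using p by (auto simp: raise_ops_0)
    show "order 1 f \<in> insert 0 {k + 1..k + r}"
    proof (cases "poly f 1 = 0")
      case True
      then have "[:-1, 1:] dvd p"
        using p by (simp add: poly_raise_ops_1 poly_eq_0_iff_dvd)
      then have "Suc k \<le> order 1 f"
        using power_dvd_raise_ops[of p bs] order_ge_iff_dvd[of f "Suc k" 1] p by simp
      moreover have "\<not> [:-1, 1:] ^ (k + r + 1) dvd f"
        using raise_ops_nondegenerate_at_1[OF p(1)] p \<open>p \<noteq> 0\<close> by blast
      then have "order 1 f < k + r + 1"
        using order_ge_iff_dvd[of f "k + r + 1" 1] by auto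
      ultimately show ?thesis by simp
    qed (simp add: order_0I)
  qed
qed simp

lemma admissible_gens: "admissible gens"
  unfolding admissible_def
  using dim_gens orders_0_gens degrees_gens orders_1_gens by (simp add: gens_def poly_vs.subspace_span)

lemma finite_dim_admissible:
  assumes "admissible W"
  obtains T where "finite T" "W = poly_vs.span T"
proof -
  obtain B where B: "B \<subseteq> W" "poly_vs.independent B" "W \<subseteq> poly_vs.span B" "card B = poly_vs.dim W"
    using poly_vs.basis_exists by blast
  have "finite B" using assms B(4) by (intro card_ge_0_finite) (simp add: admissible_def)
  moreover have "W = poly_vs.span B"
    using B assms poly_vs.span_minimal by (intro antisym) (auto simp: admissible_def)
  ultimately show ?thesis using that by blast
qed

lemma ex_mono: "i < j \<Longrightarrow> j \<le> r \<Longrightarrow> ex i < ex j"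
  using block_apart[of i j] by simp

text \<open>The elements of degree at most $e_i$ form a subspace with $i+1$ degrees, hence with $i+1$ orders at
  $0$; one of these is at least $o_i$. An element of that order cannot vanish at $1$: it would vanish
  there to order at least $k+1$, and its degree would be at least $o_i + k + 1$.\<close>

lemma admissible_has_generator:
  assumes W: "admissible W" and i: "i \<le> r"
  shows "\<exists>f\<in>W. monom 1 (ex i) dvd f \<and> degree f + d i \<le> ex i + k \<and> poly f 1 = 1"
proof -
  note W' = W[unfolded admissible_def]
  obtain T where T: "finite T" "W = poly_vs.span T" using finite_dim_admissible[OF W] .
  define U where "U = {f \<in> W. f = 0 \<or> int (degree f) < int (ex i) + int k - int (d i) + 1}"
  have "U = W \<inter> {f. f = 0 \<or> int (degree f) < int (ex i) + int k - int (d i) + 1}"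
    by (auto simp: U_def)
  then have subU: "poly_vs.subspace U"
    using W' degree_grade.subspace_below by (simp only: poly_vs.subspace_inter)
  have UT: "U \<subseteq> poly_vs.span T" using T by (auto simp: U_def)
  define e where "e = (\<lambda>i. int k + int (ex i) - int (d i))"
  have e_mono: "e a < e b" if "a < b" "b \<le> r" for a b
    using degree_gen_mono[OF that] int_degree_gen[of a] int_degree_gen[of b] that
    by (simp add: e_def)
  have degW: "(\<lambda>f. int (degree f)) ` (W - {0}) = e ` {0..r}" using W' by (simp add: e_def)
  have "e ` {0..i} \<subseteq> (\<lambda>f. int (degree f)) ` (U - {0})"
  proof (intro image_subsetI)
    fix a assume a: "a \<in> {0..i}"
    then have "e a \<in> (\<lambda>f. int (degree f)) ` (W - {0})" using i degW by auto
    then obtain f where f: "f \<in> W" "f \<noteq> 0" "e a = int (degree f)" unfolding image_iff by blast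
    moreover have "e a \<le> e i" using a i e_mono[of a i] by (cases "a = i") auto
    ultimately have "f \<in> U - {0}" by (simp add: U_def e_def)
    then show "e a \<in> (\<lambda>f. int (degree f)) ` (U - {0})" using f(3) by (rule rev_image_eqI)
  qed
  moreover have "inj_on e {0..i}" 
  proof (rule linorder_inj_onI)
    fix a b assume "a < b" "a \<in> {0..i}" "b \<in> {0..i}"
    then show "e a \<noteq> e b" using e_mono[of a b] i by simp
  qed auto
  ultimately have "Suc i \<le> card ((\<lambda>f. int (degree f)) ` (U - {0}))"
    using degree_grade.card_grades_eq_dim(1)[OF subU T(1) UT]
    by (metis card_image card_mono card_atLeastAtMost diff_zero)
  also have "\<dots> = card (order 0 ` (U - {0}))"
    using degree_grade.card_grades_eq_dim(2)[OF subU T(1) UT] card_orders_eq_dim(2)[OF subU T(1) UT, of 0]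
    by simp
  finally have card: "Suc i \<le> card (order 0 ` (U - {0}))" .
  have "\<not> order 0 ` (U - {0}) \<subseteq> ex ` {0..<i}"
  proof
    assume "order 0 ` (U - {0}) \<subseteq> ex ` {0..<i}"
    then have "card (order 0 ` (U - {0})) \<le> card (ex ` {0..<i})" by (intro card_mono) auto
    also have "\<dots> \<le> i" using card_image_le[of "{0..<i}" ex] by simp
    finally show False using card by simp
  qed
  then obtain f where f: "f \<in> U" "f \<noteq> 0" "order 0 f \<notin> ex ` {0..<i}" by auto
  have fW: "f \<in> W" using f by (simp add: U_def)
  then have "order 0 f \<in> ex ` {0..r}" using W' f by blast
  then obtain j where j: "j \<le> r" "order 0 f = ex j" by auto
  then have "\<not> j < i" using f by auto
  then have o: "ex i \<le> order 0 f" using j ex_mono[of i j] by (cases "i = j") auto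
  have df: "degree f + d i \<le> ex i + k" using f by (auto simp: U_def)
  have "poly f 1 \<noteq> 0"
  proof
    assume "poly f 1 = 0"
    then have "order 1 f \<noteq> 0" using f(2) order_root[of f 1] by simp
    moreover have "order 1 f \<in> insert 0 {k + 1..k + r}" using W' fW f(2) by blast
    ultimately have "k + 1 \<le> order 1 f" by auto
    moreover have "order 0 f + order 1 f \<le> degree f"
    proof -
      obtain g where g: "f = monom 1 (order 0 f) * g" using monom_1_dvd_iff[OF f(2)] by (metis dvdE order_refl)
      have g0: "g \<noteq> 0" using g f(2) by auto
      then have "order 1 f = order 1 g"
        by (subst g, subst order_mult) (simp_all add: order_0I poly_monom)
      moreover have "degree f = order 0 f + degree g"
        using g0 by (subst g, subst degree_mult_eq) (simp_all add: degree_monom_eq)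
      ultimately show ?thesis using order_degree[OF g0, of 1] by simp
    qed
    ultimately show False using df o by simp
  qed
  then have "smult (inverse (poly f 1)) f \<in> W" "poly (smult (inverse (poly f 1)) f) 1 = 1"
    using W' fW by (auto intro: poly_vs.subspace_scale)
  moreover have "monom 1 (ex i) dvd f" using o monom_1_dvd_iff[OF f(2)] by blast
  ultimately show ?thesis using df by (intro bexI[of _ "smult (inverse (poly f 1)) f"]) (auto intro: dvd_smult)
qed

lemma admissible_cong_mod:
  assumes W: "admissible W" and "f \<in> W" "g \<in> W" "poly f 1 = poly g 1"
  shows "[:-1, 1:] ^ Suc k dvd f - g"
proof (cases "f - g = 0")
  case False
  note W' = W[unfolded admissible_def]
  have "f - g \<in> W" using assms W' by (auto intro: poly_vs.subspace_diff)
  then have "order 1 (f - g) \<in> insert 0 {k + 1..k + r}" using W' False by blast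
  moreover have "order 1 (f - g) \<noteq> 0" using False assms(4) order_root[of "f - g" 1] by simp
  ultimately show ?thesis using order_ge_iff_dvd[of "f - g" "Suc k" 1] by auto
qed (simp only: dvd_0_right)

text \<open>The Hermite--Pade problem. Write $u_i = x^{o_i} v_i$ with $\deg v_i \le k - d_i$. For $b = o_i - c$ in the
  $i$-th block, $x^{o_r - b} v_r$ agrees with $x^c v_i$ modulo $(x-1)^{k+1}$, hence with a polynomial
  of degree less than $k$. This gives $k$ exponents $a = o_r - b$, and $v_r Q$ agrees
  with a polynomial of degree less than $k$ for every combination $Q$ of the $x^a$. Suppose that
  $v_r$ has order $\nu$ at $1$, with $1 \le \nu \le k$. By \<open>orders_span_monom\<close> some $Q$ has
  order $k - \nu$; then $v_r Q$ has order exactly $k$, and so does a polynomial of degree less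
  than $k$, which is absurd.\<close>

lemma congruent_family_eq_0:
  fixes u :: "nat \<Rightarrow> complex poly"
  assumes u0: "\<And>i. i \<le> r \<Longrightarrow> monom 1 (ex i) dvd u i"
    and deg: "\<And>i. i \<le> r \<Longrightarrow> u i = 0 \<or> degree (u i) + d i \<le> ex i + k"
    and cong: "\<And>i. i \<le> r \<Longrightarrow> [:-1, 1:] ^ Suc k dvd u r - u i"
    and at1: "poly (u r) 1 = 0"
    and i: "i \<le> r"
  shows "u i = 0"
proof -
  define v where "v i = u i div monom 1 (ex i)" for i
  have uv: "u i = monom 1 (ex i) * v i" if "i \<le> r" for i
    using u0[OF that] by (simp add: v_def)
  have deg_v: "degree (v i) + d i \<le> k" if "i \<le> r" for i
  proof (cases "v i = 0")
    case False
    then show ?thesis using deg[OF that] uv[OF that] by (auto simp: degree_mult_eq degree_monom_eq)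
  qed (use d_le_k that in simp)
  \<comment> \<open>polynomials whose Taylor coefficient of order $k$ at $1$ vanishes\<close>
  define Z where "Z = {h. \<exists>g. (g = 0 \<or> degree g < k) \<and> [:-1, 1:] ^ Suc k dvd h - (g :: complex poly)}"
  have "poly_vs.subspace Z"
  proof (rule poly_vs.subspaceI)
    fix h h' assume "h \<in> Z" "h' \<in> Z"
    then obtain g g' where g: "g = 0 \<or> degree g < k" "[:-1, 1:] ^ Suc k dvd h - g"
        "g' = 0 \<or> degree g' < k" "[:-1, 1:] ^ Suc k dvd h' - g'"
      unfolding Z_def by blast
    have "g + g' = 0 \<or> degree (g + g') < k" using g(1,3) degree_add_le_max[of g g'] by auto
    moreover have "h + h' - (g + g') = (h - g) + (h' - g')" by simp
    ultimately show "h + h' \<in> Z" unfolding Z_def using dvd_add[OF g(2,4)] by (metis (mono_tags, lifting) mem_Collect_eq)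
  next
    fix c h assume "h \<in> Z"
    then obtain g where g: "g = 0 \<or> degree g < k" "[:-1, 1:] ^ Suc k dvd h - g"
      unfolding Z_def by blast
    show "smult c h \<in> Z"
      unfolding Z_def using g dvd_smult[OF g(2), of c]
      by (intro CollectI exI[of _ "smult c g"]) (auto simp: smult_diff_right simp del: power_Suc)
  qed (auto simp: Z_def intro!: exI[of _ 0])
  define A where "A = (\<lambda>b. nat (int (ex r) - b)) ` set bs"
  have b_le: "b \<le> int (ex r)" if "b \<in> set bs" for b
  proof -
    have "b \<in> {int (ex i) - int c | i c. i \<le> r \<and> c < d i}" using that by (simp only: set_bs)
    then obtain i c where "b = int (ex i) - int c" "i \<le> r" by auto
    then show ?thesis using ex_mono[of i r] by (cases "i = r") auto
  qed
  then have cardA: "card A = k"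
    unfolding A_def distinct_card[OF distinct_bs, symmetric]
    by (intro card_image inj_onI) (metis eq_nat_nat_iff diff_ge_0_iff_ge diff_diff_eq2 add_diff_cancel_left')
  have Z: "v r * monom 1 a \<in> Z" if a: "a \<in> A" for a
  proof -
    obtain b where b: "b \<in> set bs" "a = nat (int (ex r) - b)" using a by (auto simp: A_def)
    then have "b \<in> {int (ex i) - int c | i c. i \<le> r \<and> c < d i}" by (simp only: set_bs)
    then obtain i c where ic: "i \<le> r" "c < d i" "b = int (ex i) - int c" by auto
    then have "int a = int (ex r) - (int (ex i) - int c)" using b b_le[OF b(1)] by simp
    then have a': "a + ex i = ex r + c" by linarith
    have "[:-1, 1:] ^ Suc k dvd monom 1 c * (u r - u i)"
      using cong[OF ic(1)] by (rule dvd_mult)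
    also have "monom 1 c * (u r - u i) = monom 1 (ex i) * (v r * monom 1 a - monom 1 c * v i)"
    proof -
      have "monom 1 (ex i) * (v r * monom 1 a) = monom 1 (a + ex i) * v r"
        by (simp add: mult.commute[of "v r"] mult.assoc[symmetric] mult_monom add.commute)
      also have "\<dots> = monom 1 c * (monom 1 (ex r) * v r)"
        by (simp add: a' mult.assoc[symmetric] mult_monom add.commute)
      finally show ?thesis
        unfolding uv[OF ic(1)] uv[OF order_refl]
        by (simp only: right_diff_distrib mult.left_commute[of "monom 1 c" "monom 1 (ex i)"])
    qed
    finally have "[:-1, 1:] ^ Suc k dvd v r * monom 1 a - monom 1 c * v i"
      unfolding power_dvd_iff_cancel_monom .
    moreover have "degree (monom 1 c * v i) < k"
      using degree_mult_le[of "monom 1 c" "v i"] deg_v[OF ic(1)] ic(2) by (simp add: degree_monom_eq)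
    ultimately show ?thesis unfolding Z_def by blast
  qed
  have "[:-1, 1:] ^ Suc k dvd v r"
  proof (rule ccontr)
    assume "\<not> ?thesis"
    then have ord: "v r \<noteq> 0" "order 1 (v r) \<le> k"
      using order_ge_iff_dvd[of "v r" "Suc k" 1] by auto
    have "order 1 (v r) \<noteq> 0"
      using at1 ord(1) order_root[of "v r" 1] unfolding uv[OF order_refl] by (simp add: poly_monom)
    then have "k - order 1 (v r) \<in> order 1 ` (poly_vs.span (monom 1 ` A) - {0})"
      using ord orders_span_monom[of A] cardA by (simp add: A_def)
    then obtain Q where Q: "Q \<in> poly_vs.span (monom 1 ` A)" "Q \<noteq> 0" "k - order 1 (v r) = order 1 Q"
      unfolding image_iff by blast
    have "order 1 (v r * Q) = k" using Q ord by (simp add: order_mult)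
    have "poly_vs.subspace {Q. v r * Q \<in> Z}"
      using \<open>poly_vs.subspace Z\<close> unfolding poly_vs.subspace_def by (simp add: distrib_left)
    moreover have "monom 1 ` A \<subseteq> {Q. v r * Q \<in> Z}"
      using Z by (intro image_subsetI CollectI)
    ultimately have "poly_vs.span (monom 1 ` A) \<subseteq> {Q. v r * Q \<in> Z}"
      by (intro poly_vs.span_minimal)
    then have "v r * Q \<in> Z" using Q(1) by (rule subsetD[THEN CollectD])
    then obtain g where g: "g = 0 \<or> degree g < k" "[:-1, 1:] ^ Suc k dvd v r * Q - g"
      unfolding Z_def by (elim CollectE exE conjE)
    have vQ: "v r * Q \<noteq> 0" using ord Q by simp
    have "[:-1, 1:] ^ k dvd v r * Q" using order_ge_iff_dvd[of "v r * Q" k 1] \<open>order 1 (v r * Q) = k\<close> by simp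
    moreover have "[:-1, 1:] ^ k dvd v r * Q - g" using g(2) by (rule power_le_dvd) simp
    ultimately have "[:-1, 1:] ^ k dvd g" by (metis dvd_diff_right_iff)
    then have "g = 0" using g(1) order_ge_iff_dvd[of g k 1] order_degree[of g 1] by force
    then show False
      using g(2) order_ge_iff_dvd[of "v r * Q" "Suc k" 1] vQ \<open>order 1 (v r * Q) = k\<close> by auto
  qed
  then have "[:-1, 1:] ^ Suc k dvd u r" unfolding uv[OF order_refl] by (rule dvd_mult)
  then have "[:-1, 1:] ^ Suc k dvd u i" using cong[OF i] by (metis dvd_diff_right_iff)
  then have "[:-1, 1:] ^ Suc k dvd v i" unfolding uv[OF i] power_dvd_iff_cancel_monom .
  then have "v i = 0"
    using deg_v[OF i] order_ge_iff_dvd[of "v i" "Suc k" 1] order_degree[of "v i" 1] by force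
  then show ?thesis using uv[OF i] by simp
qed

text \<open>The normalisation $F_i(1) = (-1)^k k!$ is the same for all $i$, so one factor $z$ makes the values of
  $z f_i$ and $F_i$ at $1$ equal for all $i$ at once, and their differences are congruent to one another.\<close>

theorem admissible_unique:
  assumes "admissible W"
  shows "W = gens"
proof -
  note W' = assms[unfolded admissible_def]
  obtain f where f: "\<And>i. i \<le> r \<Longrightarrow> f i \<in> W" "\<And>i. i \<le> r \<Longrightarrow> monom 1 (ex i) dvd f i"
      "\<And>i. i \<le> r \<Longrightarrow> degree (f i) + d i \<le> ex i + k" "\<And>i. i \<le> r \<Longrightarrow> poly (f i) 1 = 1"
    using admissible_has_generator[OF assms] by metis
  define z :: complex where "z = (-1) ^ k * fact k"
  define u where "u i = smult z (f i) - gen i" for i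
  have "u i = 0" if "i \<le> r" for i
  proof (rule congruent_family_eq_0[of u])
    fix i assume i: "i \<le> r"
    have "monom 1 (ex i) dvd gen i"
      using monom_1_dvd_iff[OF gen_nonzero] order_0_gen[OF i] by simp
    then show "monom 1 (ex i) dvd u i" using f(2)[OF i] by (auto simp: u_def intro: dvd_smult dvd_diff)
    have "degree (u i) \<le> ex i + k - d i"
      unfolding u_def using f(3)[OF i] degree_gen[OF i]
      by (intro degree_diff_le order_trans[OF degree_smult_le]) auto
    then show "u i = 0 \<or> degree (u i) + d i \<le> ex i + k"
      using d_le_k[OF i] by auto
    have "u r - u i = smult z (f r - f i) - (gen r - gen i)"
      by (simp add: u_def smult_diff_right)
    moreover have "[:-1, 1:] ^ Suc k dvd f r - f i"
      using f i by (intro admissible_cong_mod[OF assms]) auto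
    ultimately show "[:-1, 1:] ^ Suc k dvd u r - u i"
      using gen_cong_mod[of r i] dvd_smult[of _ "f r - f i" z] by (metis dvd_diff)
  qed (use that f(4)[of r] in \<open>simp_all add: u_def poly_gen_1 z_def\<close>)
  then have "gen i = smult z (f i)" if "i \<le> r" for i using that by (simp add: u_def)
  then have "gen ` {0..r} \<subseteq> W" using f(1) W' by (auto intro: poly_vs.subspace_scale)
  then have "gens \<subseteq> W" unfolding gens_def using W' by (intro poly_vs.span_minimal) auto
  have "poly_vs.span gens = W"
  proof (rule degree_grade.span_eq_if_grades)
    show "(\<lambda>f. int (degree f)) ` (W - {0}) \<subseteq> (\<lambda>f. int (degree f)) ` (gens - {0})"
      using W' degrees_gens by (simp only:)
  qed (use W' \<open>gens \<subseteq> W\<close> in auto)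
  then show ?thesis by (simp add: gens_def poly_vs.span_span)
qed

end

section \<open>The order of the composite as a differential operator\<close>

lemma diffop_raise_op:
  assumes "diffop_of_order n L"
  shows "diffop_of_order (Suc n) (\<lambda>f. raise_op k b (L f))"
proof -
  obtain a where a: "a n \<noteq> 0" "\<And>f. L f = (\<Sum>i\<le>n. a i * (pderiv ^^ i) f)"
    using assms unfolding diffop_of_order_def by blast
  \<comment> \<open>\<open>a1\<close> collects the terms in which the derivation hits a derivative of \<open>f\<close>, \<open>a0\<close> the others\<close>
  define p :: "complex poly" where "p = [:0, 1:] * [:-1, 1:]"
  define c :: "complex poly" where "c = - of_int (b + int k) * [:-1, 1:] - of_nat (k + 1)"
  define a0 where "a0 i = (if i \<le> n then p * pderiv (a i) + c * a i else 0)" for i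
  define a1 where "a1 i = (case i of 0 \<Rightarrow> 0 | Suc j \<Rightarrow> p * a j)" for i
  have "raise_op k b (L f) = (\<Sum>i\<le>Suc n. (a0 i + a1 i) * (pderiv ^^ i) f)" for f
  proof -
    have "raise_op k b (L f) = p * pderiv (L f) + c * L f"
    proof -
      have "P * A - z * Y * F - n * F = P * A + (- z * Y - n) * F" for P A z Y F n :: "complex poly"
        by (simp add: algebra_simps)
      then show ?thesis unfolding raise_op_def p_def c_def .
    qed
    also have "\<dots> = (\<Sum>i\<le>n. a0 i * (pderiv ^^ i) f) + (\<Sum>i\<le>n. a1 (Suc i) * (pderiv ^^ Suc i) f)"
    proof -
      have step: "p * pderiv (a i * (pderiv ^^ i) f) + c * (a i * (pderiv ^^ i) f) =
          a0 i * (pderiv ^^ i) f + a1 (Suc i) * (pderiv ^^ Suc i) f" if "i \<le> n" for i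
      proof -
        have "p * (a i * G') + p * (G * pderiv (a i)) + c * (a i * G) = (p * pderiv (a i) + c * a i) * G + p * a i * G'"
          for G G' by (simp add: algebra_simps)
        then show ?thesis using that by (simp add: pderiv_mult a0_def a1_def distrib_left)
      qed
      show ?thesis
        unfolding a(2) higher_pderiv_sum[of 1, simplified] sum_distrib_left sum.distrib[symmetric]
        by (intro sum.cong refl step) simp
    qed
    also have "(\<Sum>i\<le>n. a0 i * (pderiv ^^ i) f) = (\<Sum>i\<le>Suc n. a0 i * (pderiv ^^ i) f)"
      by (simp add: a0_def)
    also have "(\<Sum>i\<le>n. a1 (Suc i) * (pderiv ^^ Suc i) f) = (\<Sum>i\<le>Suc n. a1 i * (pderiv ^^ i) f)"
      by (subst sum.atMost_Suc_shift) (simp add: a1_def)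
    finally show ?thesis by (simp only: sum.distrib[symmetric] distrib_right)
  qed
  moreover have "p \<noteq> 0" by (simp add: p_def)
  then have "a0 (Suc n) + a1 (Suc n) \<noteq> 0" using a(1) by (simp add: a0_def a1_def)
  ultimately show ?thesis
    unfolding diffop_of_order_def by (intro exI[of _ "\<lambda>i. a0 i + a1 i"]) auto
qed

lemma diffop_raise_ops: "diffop_of_order (length bs) (raise_ops bs)"
proof (induction bs)
  case Nil
  show ?case unfolding diffop_of_order_def by (intro exI[of _ "\<lambda>_. 1"]) simp
next
  case (Cons b bs)
  show ?case using diffop_raise_op[OF Cons] by simp
qed

section \<open>Sequences of indices and consistent parameters\<close>

definition base_exp :: "(nat \<Rightarrow> nat) \<Rightarrow> nat \<Rightarrow> nat" where
  "base_exp m i = i + (\<Sum>s=1..i. m s)"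

definition l_drop :: "nat \<Rightarrow> (nat \<Rightarrow> nat) \<Rightarrow> nat \<Rightarrow> nat \<Rightarrow> nat" where
  "l_drop r l k i = nat (ext_l r l k i - ext_l r l k (i + 1))"

text \<open>How often the index $i$ has been used in the first $t$ steps. This is $l_i - l_{i+1}$ for the partial
  sum $l$ of the first $t$ steps, including the cases $i = 0$ and $i = r$ with their conventions.\<close>

definition occurrences :: "(nat \<Rightarrow> nat) \<Rightarrow> nat \<Rightarrow> nat \<Rightarrow> nat" where
  "occurrences j t i = card {s \<in> {1..t}. j s = i}"

primrec exponents :: "(nat \<Rightarrow> nat) \<Rightarrow> (nat \<Rightarrow> nat) \<Rightarrow> nat \<Rightarrow> int list" where
  "exponents m j 0 = []"
| "exponents m j (Suc t) = (int (base_exp m (j (Suc t))) - int (occurrences j t (j (Suc t)))) # exponents m j t"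

lemma length_exponents [simp]: "length (exponents m j t) = t"
  by (induction t) simp_all

lemma occurrences_Suc: "occurrences j (Suc t) i = occurrences j t i + (if j (Suc t) = i then 1 else 0)"
proof -
  have "{s \<in> {1..Suc t}. j s = i} = {s \<in> {1..t}. j s = i} \<union> (if j (Suc t) = i then {Suc t} else {})"
    by (auto simp: le_Suc_eq)
  then show ?thesis by (simp add: occurrences_def card_insert_if)
qed

lemma set_exponents:
  assumes "\<forall>s\<in>{1..t}. j s \<le> r"
  shows "set (exponents m j t) = {int (base_exp m i) - int c | i c. i \<le> r \<and> c < occurrences j t i}"
  using assms
proof (induction t)
  case (Suc t)
  let ?i = "j (Suc t)"
  have "?i \<le> r" using Suc.prems by simp
  have "{int (base_exp m i) - int c | i c. i \<le> r \<and> c < occurrences j (Suc t) i} =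
      insert (int (base_exp m ?i) - int (occurrences j t ?i)) {int (base_exp m i) - int c | i c. i \<le> r \<and> c < occurrences j t i}"
    (is "?A = insert ?x ?B")
  proof (intro equalityI subsetI)
    fix y assume "y \<in> ?A"
    then obtain i c where "y = int (base_exp m i) - int c" "i \<le> r" "c < occurrences j (Suc t) i" by blast
    then show "y \<in> insert ?x ?B" unfolding occurrences_Suc by (cases "c < occurrences j t i") (auto split: if_splits)
  next
    fix y assume "y \<in> insert ?x ?B"
    then consider "y = ?x" | i c where "y = int (base_exp m i) - int c" "i \<le> r" "c < occurrences j t i"
      by blast
    then show "y \<in> ?A"
    proof cases
      case 1
      then show ?thesis using \<open>?i \<le> r\<close> occurrences_Suc[of j t ?i]
        by (intro CollectI exI[of _ ?i] exI[of _ "occurrences j t ?i"]) simp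
    next
      case 2
      then show ?thesis using occurrences_Suc[of j t i] by (intro CollectI exI[of _ i] exI[of _ c]) simp
    qed
  qed
  then show ?case using Suc by simp
qed (simp add: occurrences_def)

lemma ext_l_partial_l:
  assumes "\<forall>s\<in>{1..t}. j s \<le> r" "i \<le> r + 1"
  shows "ext_l r (partial_l j t) t i = int (card {s \<in> {1..t}. i \<le> j s})"
proof -
  consider "i = 0" | "1 \<le> i" "i \<le> r" | "i = r + 1" using assms(2) by linarith
  then show ?thesis
  proof cases
    case 1
    then have all: "{s \<in> {1..t}. i \<le> j s} = {1..t}" by auto
    show ?thesis unfolding all using 1 by (simp add: ext_l_def)
  next
    case 2
    then have "partial_l j t i = card {s \<in> {1..t}. i \<le> j s}"
      by (simp add: partial_l_def one_vec_def sum.If_cases Int_def)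
    then show ?thesis using 2 by (simp only: ext_l_def) simp
  next
    case 3
    then have none: "{s \<in> {1..t}. i \<le> j s} = {}" using assms(1) by force
    show ?thesis unfolding none using 3 by (simp add: ext_l_def)
  qed
qed

lemma ext_l_partial_l_diff:
  assumes "\<forall>s\<in>{1..t}. j s \<le> r" "i \<le> r"
  shows "ext_l r (partial_l j t) t i - ext_l r (partial_l j t) t (i + 1) = int (occurrences j t i)"
proof -
  have "{s \<in> {1..t}. i \<le> j s} = {s \<in> {1..t}. i + 1 \<le> j s} \<union> {s \<in> {1..t}. j s = i}" by auto
  then have "card {s \<in> {1..t}. i \<le> j s} = card {s \<in> {1..t}. i + 1 \<le> j s} + card {s \<in> {1..t}. j s = i}"
    by (subst card_Un_disjoint[symmetric]) auto
  then show ?thesis using assms by (simp add: ext_l_partial_l occurrences_def)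
qed

lemma e_alt: "e r m i l k = int k + int (base_exp m i) - (ext_l r l k i - ext_l r l k (i + 1))"
  by (simp add: e_def base_exp_def)

text \<open>In the $(t+1)$-st factor, $e_i - t = o_i - d_i$, and $d_i$ is the number of earlier
  occurrences of $i$.\<close>

lemma D_comp_eq_raise_ops:
  assumes "\<forall>s\<in>{1..t}. j s \<le> r"
  shows "D_comp r m j t = raise_ops (exponents m j t)"
  using assms
proof (induction t)
  case (Suc t)
  then have "e r m (j (Suc t)) (partial_l j t) t =
      (int (base_exp m (j (Suc t))) - int (occurrences j t (j (Suc t)))) + int t"
    by (subst e_alt, subst ext_l_partial_l_diff) auto
  then show ?case using Suc by (simp add: fun_eq_iff D_def raise_op_def)
qed (simp add: fun_eq_iff)

lemma consistent_l_drop: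
  assumes "consistent r m l k" "i \<le> r"
  shows "int (l_drop r l k i) = ext_l r l k i - ext_l r l k (i + 1)"
  using assms by (auto simp: consistent_def l_drop_def)

lemma sum_l_drop:
  assumes "consistent r m l k"
  shows "(\<Sum>i\<le>r. l_drop r l k i) = k"
proof -
  have "int (\<Sum>i\<le>r. l_drop r l k i) = (\<Sum>i\<le>r. ext_l r l k i - ext_l r l k (Suc i))"
    unfolding of_nat_sum using consistent_l_drop[OF assms] by (intro sum.cong) auto
  also have "\<dots> = int k" by (subst sum_telescope) (simp add: ext_l_def)
  finally show ?thesis by (simp only: of_nat_eq_iff)
qed

text \<open>The condition $l_i - l_{i+1} \le m_i$ is what keeps the block of $o_i = o_{i-1} + m_i + 1$ above
  $o_{i-1}$.\<close>

lemma exponent_blocksI: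
  assumes c: "consistent r m l k" and "length bs = k"
    and "set bs = {int (base_exp m i) - int c | i c. i \<le> r \<and> c < l_drop r l k i}"
  shows "exponent_blocks r (base_exp m) (l_drop r l k) bs"
proof
  fix i assume "i < r"
  then have "Suc i \<in> {1..r}" by simp
  then have "ext_l r l k (Suc i) - ext_l r l k (Suc i + 1) \<le> int (m (Suc i))"
    using c unfolding consistent_def by blast
  then have "l_drop r l k (Suc i) \<le> m (Suc i)" by (simp add: l_drop_def)
  then show "base_exp m i + l_drop r l k (Suc i) < base_exp m (Suc i)"
    by (simp add: base_exp_def)
qed (use assms sum_l_drop[OF c] in simp_all)

lemma V_eq_image_raise_ops:
  assumes c: "consistent r m l k" and "length bs = k"
    and "set bs = {int (base_exp m i) - int c | i c. i \<le> r \<and> c < l_drop r l k i}"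
  shows "V r m l k = raise_ops bs ` poly_vs.span (monom 1 ` base_exp m ` {0..r})"
proof -
  interpret exponent_blocks r "base_exp m" "l_drop r l k" bs
    using assms by (rule exponent_blocksI)
  have "(\<lambda>i. e r m i l k) ` {0..r} = (\<lambda>i. int k + int (base_exp m i) - int (l_drop r l k i)) ` {0..r}"
    by (intro image_cong) (simp_all add: e_alt consistent_l_drop[OF c])
  then have iff: "is_V r m l k W \<longleftrightarrow> admissible W" for W
    unfolding is_V_def admissible_def assms(2) by (simp add: base_exp_def[abs_def])
  show ?thesis
    unfolding V_def iff gens_eq_image[symmetric]
    using admissible_gens by (rule the_equality) (rule admissible_unique)
qed

lemma l_drop_eq_occurrences:
  assumes "\<forall>s\<in>{1..k}. j s \<le> r" "\<forall>i\<in>{1..r}. (\<Sum>s=1..k. one_vec (j s) i) = l i" "i \<le> r"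
  shows "l_drop r l k i = occurrences j k i"
proof -
  have "ext_l r l k i = ext_l r (partial_l j k) k i" for i
    using assms(2) by (auto simp: ext_l_def partial_l_def)
  then show ?thesis using ext_l_partial_l_diff[OF assms(1,3)] by (simp add: l_drop_def)
qed

lemma consistent_antimono:
  assumes "consistent r m l k" "i \<le> i'" "i' \<le> r"
  shows "ext_l r l k i' \<le> ext_l r l k i"
  using assms(2,3)
proof (induction rule: dec_induct)
  case (step n)
  then have "ext_l r l k (n + 1) \<le> ext_l r l k n" using assms(1) by (simp add: consistent_def)
  then show ?case using step by simp
qed simp

text \<open>Take for $j(s)$ the largest $i$ with $s \le l_i$. As $l$ is decreasing, this is the number of such
  $i$, and $i \le j(s)$ is equivalent to $s \le l_i$.\<close>

lemma consistent_sequence_exists: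
  assumes c: "consistent r m l k"
  obtains j where "\<forall>s\<in>{1..k}. j s \<in> {0..r}" "\<forall>i\<in>{1..r}. (\<Sum>s=1..k. one_vec (j s) i) = l i"
proof
  define j where "j s = card {i \<in> {1..r}. s \<le> l i}" for s
  have anti: "l b \<le> l a" if "1 \<le> a" "a \<le> b" "b \<le> r" for a b
    using consistent_antimono[OF c that(2,3)] that by (simp add: ext_l_def)
  have "j s \<le> r" for s
  proof -
    have "j s \<le> card {1..r}" unfolding j_def by (intro card_mono) auto
    then show ?thesis by simp
  qed
  then show "\<forall>s\<in>{1..k}. j s \<in> {0..r}" by simp
  show "\<forall>i\<in>{1..r}. (\<Sum>s=1..k. one_vec (j s) i) = l i"
  proof
    fix i assume i: "i \<in> {1..r}"
    have le: "i \<le> j s \<longleftrightarrow> s \<le> l i" for s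
    proof
      assume "s \<le> l i"
      then have "{1..i} \<subseteq> {i \<in> {1..r}. s \<le> l i}"
        using i anti[of _ i] by fastforce
      then have "card {1..i} \<le> j s" unfolding j_def by (intro card_mono) auto
      then show "i \<le> j s" by simp
    next
      assume "i \<le> j s"
      show "s \<le> l i"
      proof (rule ccontr)
        assume "\<not> s \<le> l i"
        then have "{i \<in> {1..r}. s \<le> l i} \<subseteq> {1..<i}"
          using i anti[of i] by (fastforce simp: not_less[symmetric])
        then have "j s \<le> card {1..<i}" unfolding j_def by (intro card_mono) auto
        moreover have "card {1..<i} < i" using i by simp
        ultimately show False using \<open>i \<le> j s\<close> by linarith
      qed
    qed
    have "(\<Sum>s=1..k. one_vec (j s) i) = card {s \<in> {1..k}. s \<le> l i}"
      using i by (simp add: one_vec_def le sum.If_cases Int_def)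
    also have "l i \<le> k" using consistent_antimono[OF c, of 0 i] i by (simp add: ext_l_def)
    then have "{s \<in> {1..k}. s \<le> l i} = {1..l i}" by auto
    finally show "(\<Sum>s=1..k. one_vec (j s) i) = l i" by simp
  qed
qed

section \<open>The factorisation\<close>

theorem corollary3p6:
  fixes r k :: nat and m l :: "nat \<Rightarrow> nat"
  assumes "r \<ge> 1"
    and "consistent r m l k"
  shows "\<exists>!L :: complex poly \<Rightarrow> complex poly.
           diffop_of_order k L \<and>
           (\<exists>j :: nat \<Rightarrow> nat. (\<forall>s\<in>{1..k}. j s \<in> {0..r}) \<and>
              (\<forall>i\<in>{1..r}. (\<Sum>s=1..k. one_vec (j s) i) = l i) \<and>
              L = D_comp r m j k) \<and>
           V r m l k = L ` V r m (\<lambda>_. 0) 0"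
proof -
  note c = assms(2)
  define B where "B = {int (base_exp m i) - int c | i c. i \<le> r \<and> c < l_drop r l k i}"
  have key: "D_comp r m j k = raise_ops (exponents m j k)" "set (exponents m j k) = B"
    if j: "\<forall>s\<in>{1..k}. j s \<in> {0..r}" "\<forall>i\<in>{1..r}. (\<Sum>s=1..k. one_vec (j s) i) = l i" for j
  proof -
    have j': "\<forall>s\<in>{1..k}. j s \<le> r" using j(1) by simp
    show "D_comp r m j k = raise_ops (exponents m j k)" using j' by (rule D_comp_eq_raise_ops)
    show "set (exponents m j k) = B"
      unfolding set_exponents[OF j'] B_def using l_drop_eq_occurrences[OF j' j(2)] by metis
  qed
  have distinct: "distinct bs" if "length bs = k" "set bs = B" for bs
    using exponent_blocks.distinct_bs[OF exponent_blocksI[OF c]] that unfolding B_def by blast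
  obtain j where j: "\<forall>s\<in>{1..k}. j s \<in> {0..r}" "\<forall>i\<in>{1..r}. (\<Sum>s=1..k. one_vec (j s) i) = l i"
    using consistent_sequence_exists[OF c] .
  show ?thesis
  proof (rule ex1I[of _ "D_comp r m j k"], intro conjI)
    show "diffop_of_order k (D_comp r m j k)"
      unfolding key(1)[OF j] using diffop_raise_ops[of "exponents m j k"] by simp
    show "\<exists>j'. (\<forall>s\<in>{1..k}. j' s \<in> {0..r}) \<and>
        (\<forall>i\<in>{1..r}. (\<Sum>s=1..k. one_vec (j' s) i) = l i) \<and> D_comp r m j k = D_comp r m j' k"
      using j by blast
    have "consistent r m (\<lambda>_. 0) 0" by (simp add: consistent_def ext_l_def)
    from V_eq_image_raise_ops[OF this, of "[]"]
    have "V r m (\<lambda>_. 0) 0 = poly_vs.span (monom 1 ` base_exp m ` {0..r})"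
      by (simp add: l_drop_def ext_l_def)
    then show "V r m l k = D_comp r m j k ` V r m (\<lambda>_. 0) 0"
      using V_eq_image_raise_ops[OF c, of "exponents m j k"] key[OF j] by (simp add: B_def)
  next
    fix L
    assume "diffop_of_order k L \<and>
       (\<exists>j. (\<forall>s\<in>{1..k}. j s \<in> {0..r}) \<and> (\<forall>i\<in>{1..r}. (\<Sum>s=1..k. one_vec (j s) i) = l i) \<and>
            L = D_comp r m j k) \<and> V r m l k = L ` V r m (\<lambda>_. 0) 0"
    then obtain j' where j': "\<forall>s\<in>{1..k}. j' s \<in> {0..r}"
        "\<forall>i\<in>{1..r}. (\<Sum>s=1..k. one_vec (j' s) i) = l i" "L = D_comp r m j' k" by blast
    have "mset (exponents m j' k) = mset (exponents m j k)"
      using key(2)[OF j] key(2)[OF j'(1,2)] distinct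
      by (subst set_eq_iff_mset_eq_distinct[symmetric]) simp_all
    then show "L = D_comp r m j k"
      unfolding j'(3) key(1)[OF j] key(1)[OF j'(1,2)] by (rule raise_ops_mset_cong)
  qed
qed

end
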